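(* $$q(5)=\log_2 3.$$
   Context: For $q>0$, a weak $\mathbb T_q$-representation of the rank-$2$ uniform matroid $U_{2,n}$ is a family of positive reals $(\rho_{ij})_{1\le i<j\le n}$ such that for all $1\le i<j<k<\ell\le n$ the three numbers $(\rho_{ij}\rho_{k\ell})^{1/q}$, $(\rho_{ik}\rho_{j\ell})^{1/q}$, $(\rho_{i\ell}\rho_{jk})^{1/q}$ are the side lengths of a (possibly degenerate) Euclidean triangle (each is at most the sum of the other two). It is identified with the quadratic form $\sum_{i<j}\rho_{ij}x_ix_j$. A quadratic form with nonnegative coefficients in $x_1,\dots,x_n$ is Lorentzian if it is a limit of quadratic forms with nonnegative coefficients whose Hessians have exactly one positive and $n-1$ negative eigenvalues (equivalently, its Hessian has at most one positive eigenvalue). $\mathrm{Gr}^{\mathrm w}_{U_{2,n}}(\mathbb T_q)$ is the set of weak $\mathbb T_q$-representations of $U_{2,n}$ modulo positive scaling, and $\mathbb P\mathrm L_{U_{2,n}}$ is the set of Lorentzian quadratic forms whose set of monomials with nonzero coefficient is exactly $\{x_ix_j:1\le i<j\le n\}$, modulo positive scaling. Define $$q(n):=\sup\{q>0 \mid \mathrm{Gr}^{\mathrm w}_{U_{2,n}}(\mathbb T_q)\subseteq\mathbb P\mathrm L_{U_{2,n}}\}.$$ *)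

theory Defs
  imports
    "HOL-Library.Poly_Mapping"
    "HOL-Library.Extended_Real"
    "Jordan_Normal_Form.Char_Poly"
begin

text \<open>
  Real polynomials in variables indexed by \<^typ>\<open>nat\<close>, as finitely supported
  functions from exponent vectors to coefficients; the forms below only use the variables
  \<open>x\<^sub>1, \<dots>, x\<^sub>n\<close>.
\<close>

type_synonym rpoly = "(nat \<Rightarrow>\<^sub>0 nat) \<Rightarrow>\<^sub>0 real"

abbreviation quad_mon :: "nat \<Rightarrow> nat \<Rightarrow> (nat \<Rightarrow>\<^sub>0 nat)" where
  "quad_mon i j \<equiv> Poly_Mapping.single i 1 + Poly_Mapping.single j 1"

definition quadratic_form :: "nat \<Rightarrow> rpoly \<Rightarrow> bool" where
  "quadratic_form n f \<longleftrightarrow>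
     (\<forall>m \<in> Poly_Mapping.keys f. Poly_Mapping.keys m \<subseteq> {1..n} \<and>
        (\<Sum>i \<in> Poly_Mapping.keys m. Poly_Mapping.lookup m i) = 2)"

definition nonneg_coeffs :: "rpoly \<Rightarrow> bool" where
  "nonneg_coeffs f \<longleftrightarrow> (\<forall>m. 0 \<le> Poly_Mapping.lookup f m)"

definition partial_deriv :: "nat \<Rightarrow> rpoly \<Rightarrow> rpoly" where
  "partial_deriv i f =
     (\<Sum>m \<in> Poly_Mapping.keys f.
        Poly_Mapping.single (m - Poly_Mapping.single i 1)
          (real (Poly_Mapping.lookup m i) * Poly_Mapping.lookup f m))"

text \<open>
  The second partial derivatives of a quadratic form are constant polynomials; the matrix
  collects their constant terms.  Matrix indices start at \<open>0\<close>, variable indices at \<open>1\<close>.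
\<close>

definition hessian :: "nat \<Rightarrow> rpoly \<Rightarrow> real mat" where
  "hessian n f =
     mat n n (\<lambda>(i, j). Poly_Mapping.lookup (partial_deriv (Suc i) (partial_deriv (Suc j) f)) 0)"

text \<open>The eigenvalues of a matrix, counted with multiplicity.\<close>

definition eigenvalues_mset :: "real mat \<Rightarrow> real multiset" where
  "eigenvalues_mset A = proots (char_poly A)"

definition strictly_lorentzian :: "nat \<Rightarrow> rpoly \<Rightarrow> bool" where
  "strictly_lorentzian n f \<longleftrightarrow>
     quadratic_form n f \<and> nonneg_coeffs f \<and>
     size {#x \<in># eigenvalues_mset (hessian n f). 0 < x#} = 1 \<and>
     size {#x \<in># eigenvalues_mset (hessian n f). x < 0#} = n - 1"

text \<open>
  Limits are taken in the finite-dimensional space of quadratic forms in \<open>n\<close> variables,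
  where convergence is convergence of every coefficient.
\<close>

definition lorentzian :: "nat \<Rightarrow> rpoly \<Rightarrow> bool" where
  "lorentzian n f \<longleftrightarrow>
     quadratic_form n f \<and> nonneg_coeffs f \<and>
     (\<exists>F :: nat \<Rightarrow> rpoly. (\<forall>k. strictly_lorentzian n (F k)) \<and>
        (\<forall>m. (\<lambda>k. Poly_Mapping.lookup (F k) m) \<longlonglongrightarrow> Poly_Mapping.lookup f m))"

definition scaling_class :: "rpoly \<Rightarrow> rpoly set" where
  "scaling_class f = {Poly_Mapping.map (\<lambda>a. c * a) f | c. 0 < c}"

definition weak_rep :: "nat \<Rightarrow> real \<Rightarrow> (nat \<Rightarrow> nat \<Rightarrow> real) \<Rightarrow> bool" where
  "weak_rep n q \<rho> \<longleftrightarrow>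
     (\<forall>i j. 1 \<le> i \<and> i < j \<and> j \<le> n \<longrightarrow> 0 < \<rho> i j) \<and>
     (\<forall>i j k l. 1 \<le> i \<and> i < j \<and> j < k \<and> k < l \<and> l \<le> n \<longrightarrow>
        (let a = (\<rho> i j * \<rho> k l) powr (1 / q);
             b = (\<rho> i k * \<rho> j l) powr (1 / q);
             c = (\<rho> i l * \<rho> j k) powr (1 / q)
         in a \<le> b + c \<and> b \<le> a + c \<and> c \<le> a + b))"

text \<open>Only the values \<open>\<rho> i j\<close> with \<open>1 \<le> i < j \<le> n\<close> enter.\<close>

definition rep_form :: "nat \<Rightarrow> (nat \<Rightarrow> nat \<Rightarrow> real) \<Rightarrow> rpoly" where
  "rep_form n \<rho> =
     (\<Sum>(i, j) \<in> {(i, j). 1 \<le> i \<and> i < j \<and> j \<le> n}. Poly_Mapping.single (quad_mon i j) (\<rho> i j))"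

definition Gr_w :: "nat \<Rightarrow> real \<Rightarrow> rpoly set set" where
  "Gr_w n q = {scaling_class (rep_form n \<rho>) | \<rho>. weak_rep n q \<rho>}"

definition PL :: "nat \<Rightarrow> rpoly set set" where
  "PL n = {scaling_class f | f. lorentzian n f \<and>
             Poly_Mapping.keys f = {quad_mon i j | i j. 1 \<le> i \<and> i < j \<and> j \<le> n}}"

text \<open>
  The supremum is taken in the extended reals, where it always exists; in \<^typ>\<open>real\<close> the
  supremum of an empty or unbounded set would be an unspecified number.
\<close>

definition q_sup :: "nat \<Rightarrow> ereal" where
  "q_sup n = Sup (ereal ` {q. 0 < q \<and> Gr_w n q \<subseteq> PL n})"

end

theory Submission
  imports Defs
begin

text \<open>
  Attach to a representation \<open>\<rho>\<close> the symmetric \<open>5 \<times> 5\<close> matrix with zero diagonal and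
  off-diagonal entries \<open>\<rho> i j\<close>; this is the Hessian of the associated quadratic form.  The idea
  is geometric: after scaling rows and columns so that the off-diagonal entries of one row are
  ones, the matrix looks like a Cayley--Menger matrix, and its other entries can be read as the
  squared distances between four points.  For four indices, the three products
  \<open>A = \<rho> i j * \<rho> k l\<close>, \<open>B = \<rho> i k * \<rho> j l\<close>,
  \<open>C = \<rho> i l * \<rho> j k\<close> are then read as the squared sides of a Euclidean triangle, and the number
  \<open>log 2 3\<close> is the threshold at which an angle of 120 degrees becomes possible: if
  \<open>0 < q < log 2 3\<close> and the numbers \<open>A powr (1 / q)\<close>, \<open>B powr (1 / q)\<close>, \<open>C powr (1 / q)\<close> are
  the sides of a triangle, then \<open>C < A + B + sqrt (A * B)\<close>
  (\<open>triangle_imp_angle_less\<close>), which by the law of cosines says that the angle opposite to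
  \<open>sqrt C\<close> is less than 120 degrees.

  If all these angles are less than 120 degrees, the determinant of the matrix is positive
  (\<open>det_hollow_mat_pos\<close>).  Indeed, three nonzero vectors with pairwise angles below 120 degrees
  have no vanishing nontrivial nonnegative combination, and algebraically this becomes a statement on
  the quadratic form of the matrix: it is negative on the nonzero vectors that are nonnegative
  in three coordinates and are annihilated by the two remaining rows
  (\<open>quadratic_form_neg_of_angles_lt_120\<close>).  Apply this to the rows of the cofactor matrix, all of
  whose diagonal entries are negative.  If the determinant were not positive, every row of the
  cofactor matrix would have exactly one off-diagonal entry that is not positive; by symmetry
  these entries would pair up the five indices, which is impossible as five is odd.

  The characteristic polynomial therefore has the form \<open>x^5 - b x^3 - c x^2 - d x - e\<close> with
  \<open>b, c, d, e > 0\<close>, so it has exactly one positive root, which is simple; since it has only real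
  roots, the four others are negative.  Hence the form is Lorentzian for \<open>q < log 2 3\<close>.

  For \<open>q > log 2 3\<close>, take the path metric of the star with a centre and three leaves, together
  with a point at infinity: \<open>\<rho> i j = 2 powr q\<close> for the three pairs of leaves and \<open>\<rho> i j = 1\<close> otherwise.
  For \<open>q = log 2 3\<close> this would be an equilateral triangle with its centre.  For \<open>q > log 2 3\<close>
  the determinant of the matrix is negative, whereas the Hessian
  determinant of a strictly Lorentzian form in five variables is positive and hence that of a
  Lorentzian form is nonnegative.
\<close>

section \<open>Triangles with sides raised to a power\<close>

text \<open>
  The numerator vanishes at \<open>0\<close> and is convex on \<open>[0, 1)\<close>, so its chord slopes from \<open>0\<close> increase.
\<close>

lemma powr_odd_part_over_id_mono:
  fixes r \<xi> \<eta> :: real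
  assumes r: "0 < r" "r < 1" and "0 < \<xi>" "\<xi> < \<eta>" "\<eta> < 1"
  shows "((1 + \<xi>) powr r - (1 - \<xi>) powr r) / \<xi> \<le> ((1 + \<eta>) powr r - (1 - \<eta>) powr r) / \<eta>"
proof -
  define \<phi> where "\<phi> t = (1 + t) powr r - (1 - t) powr r" for t :: real
  define \<phi>' where "\<phi>' t = r * ((1 + t) powr (r - 1) + (1 - t) powr (r - 1))" for t :: real
  have D: "(\<phi> has_real_derivative \<phi>' t) (at t)" if "0 \<le> t" "t < 1" for t
    unfolding \<phi>_def \<phi>'_def using that
    by (auto intro!: derivative_eq_intros simp: algebra_simps)
  have mono: "\<phi>' a \<le> \<phi>' b" if ab: "0 \<le> a" "a \<le> b" "b < 1" for a b
  proof (rule DERIV_nonneg_imp_nondecreasing[OF ab(2)])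
    fix t assume t: "a \<le> t" "t \<le> b"
    have "(\<phi>' has_real_derivative
        r * ((r - 1) * (1 + t) powr (r - 2) - (r - 1) * (1 - t) powr (r - 2))) (at t)"
      unfolding \<phi>'_def using t ab by (auto intro!: derivative_eq_intros)
    moreover have "(1 + t) powr (r - 2) \<le> (1 - t) powr (r - 2)"
      using t ab r by (intro powr_mono2') auto
    then have "0 \<le> (1 - r) * ((1 - t) powr (r - 2) - (1 + t) powr (r - 2))"
      using r by simp
    then have "0 \<le> r * ((r - 1) * (1 + t) powr (r - 2) - (r - 1) * (1 - t) powr (r - 2))"
      using r by (intro mult_nonneg_nonneg) (auto simp: algebra_simps)
    ultimately show "\<exists>y. DERIV \<phi>' t :> y \<and> y \<ge> 0" by blast
  qed
  obtain a where a: "0 < a" "a < \<xi>" "\<phi> \<xi> - \<phi> 0 = (\<xi> - 0) * \<phi>' a"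
    using MVT2[of 0 \<xi> \<phi> \<phi>'] D assms by auto
  obtain b where b: "\<xi> < b" "b < \<eta>" "\<phi> \<eta> - \<phi> \<xi> = (\<eta> - \<xi>) * \<phi>' b"
    using MVT2[of \<xi> \<eta> \<phi> \<phi>'] D assms by auto
  have "\<phi>' a \<le> \<phi>' b" using mono a b assms by auto
  then have "(\<eta> - \<xi>) * \<phi>' a \<le> \<phi> \<eta> - \<phi> \<xi>" using b assms by simp
  moreover have "\<phi> \<xi> = \<xi> * \<phi>' a" using a by (simp add: \<phi>_def)
  ultimately have "\<phi> \<xi> * \<eta> \<le> \<phi> \<eta> * \<xi>"
    using assms mult_left_mono[of "(\<eta> - \<xi>) * \<phi>' a" "\<phi> \<eta> - \<phi> \<xi>" \<xi>]
    by (simp add: algebra_simps)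
  then show ?thesis
    unfolding \<phi>_def using assms by (simp add: field_simps)
qed

text \<open>
  Both sides agree at \<open>t = 0\<close> and at \<open>t = 1\<close>, and as a function of \<open>t\<^sup>2\<close> the right-hand side
  is concave while the left-hand side is convex.
\<close>

lemma powr_pair_le_unit:
  fixes \<sigma> t :: real
  assumes \<sigma>: "3 powr \<sigma> = 2" and t: "0 \<le> t" "t < 1"
  shows "(1 + t) powr (2 * \<sigma>) + (1 - t) powr (2 * \<sigma>) \<le> (3 + t\<^sup>2) powr \<sigma>"
proof (cases "t = 0")
  case True
  then show ?thesis using \<sigma> by simp
next
  case False
  with t have t: "0 < t" "t < 1" by auto
  have s1: "1 / 2 < \<sigma>"
  proof (rule ccontr)
    assume "\<not> ?thesis"
    then have "3 powr \<sigma> \<le> 3 powr (1 / 2 :: real)" by simp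
    moreover have "(3::real) powr (1 / 2) < 2"
      by (simp add: powr_half_sqrt real_less_lsqrt)
    ultimately show False using \<sigma> by simp
  qed
  have s2: "\<sigma> < 1"
  proof (rule ccontr)
    assume "\<not> ?thesis"
    then have "3 powr 1 \<le> (3::real) powr \<sigma>" by (intro powr_mono) auto
    then show False using \<sigma> by simp
  qed
  \<comment> \<open>The absolute value only serves to make \<open>F\<close> continuous from both sides at \<open>1\<close>.\<close>
  define F where "F x = (3 + x\<^sup>2) powr \<sigma> - (1 + x) powr (2 * \<sigma>) - \<bar>1 - x\<bar> powr (2 * \<sigma>)" for x :: real
  \<comment> \<open>\<open>G\<close> is the derivative of \<open>F\<close> with respect to \<open>x\<^sup>2\<close>.\<close>
  define G where "G x = \<sigma> * ((3 + x\<^sup>2) powr (\<sigma> - 1)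
      - ((1 + x) powr (2 * \<sigma> - 1) - (1 - x) powr (2 * \<sigma> - 1)) / x)" for x :: real
  have D: "(F has_real_derivative G x * (2 * x)) (at x)" if x: "0 < x" "x < 1" for x
  proof -
    have "3 + x\<^sup>2 > 0" by (simp add: add_pos_nonneg)
    then have "((\<lambda>x. (3 + x\<^sup>2) powr \<sigma> - (1 + x) powr (2 * \<sigma>) - (1 - x) powr (2 * \<sigma>))
        has_real_derivative G x * (2 * x)) (at x)"
      unfolding G_def using x by (auto intro!: derivative_eq_intros simp: field_simps)
    then show ?thesis
      by (rule has_field_derivative_transform_within_open[where S = "{..<1}"])
        (use x in \<open>auto simp: F_def\<close>)
  qed
  have cont: "isCont F x" if "0 \<le> x" "x \<le> 1" for x
  proof -
    have "3 + x\<^sup>2 > 0" by (simp add: add_pos_nonneg)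
    then show ?thesis
      unfolding F_def isCont_def using that s1
      by (intro tendsto_intros tendsto_powr') auto
  qed
  have contg: "isCont (\<lambda>x::real. x\<^sup>2) x" for x by simp
  have Dg: "((\<lambda>x. x\<^sup>2) has_real_derivative 2 * x) (at x)" for x :: real
    by (auto intro!: derivative_eq_intros)
  \<comment> \<open>Cauchy's mean value theorem against \<open>x\<^sup>2\<close> on both sides of \<open>t\<close>; concavity is \<open>G \<eta> \<le> G \<xi>\<close>.\<close>
  obtain \<xi> where x: "0 < \<xi>" "\<xi> < t" "(F t - F 0) * (2 * \<xi>) = (t\<^sup>2 - 0\<^sup>2) * (G \<xi> * (2 * \<xi>))"
    using GMVT'[of 0 t F "\<lambda>x. x\<^sup>2" "\<lambda>x. 2 * x" "\<lambda>x. G x * (2 * x)"] D cont contg Dg t by auto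
  obtain \<eta> where y: "t < \<eta>" "\<eta> < 1" "(F 1 - F t) * (2 * \<eta>) = (1\<^sup>2 - t\<^sup>2) * (G \<eta> * (2 * \<eta>))"
    using GMVT'[of t 1 F "\<lambda>x. x\<^sup>2" "\<lambda>x. 2 * x" "\<lambda>x. G x * (2 * x)"] D cont contg Dg t by auto
  have F0: "F 0 = 0" by (simp add: F_def \<sigma>)
  have "(4::real) powr \<sigma> = (2 powr 2) powr \<sigma>" by simp
  also have "\<dots> = 2 powr (2 * \<sigma>)" by (simp only: powr_powr)
  finally have F1: "F 1 = 0" by (simp add: F_def)
  have e1: "F t = t\<^sup>2 * G \<xi>" using x F0 by simp
  have "\<eta> * (- F t) = \<eta> * ((1 - t\<^sup>2) * G \<eta>)" using y F1 by (simp add: algebra_simps)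
  then have e2: "- F t = (1 - t\<^sup>2) * G \<eta>" using y t by (metis mult_left_cancel order_less_irrefl order_less_trans)
  have "(3 + \<eta>\<^sup>2) powr (\<sigma> - 1) \<le> (3 + \<xi>\<^sup>2) powr (\<sigma> - 1)"
    using s2 x y by (intro powr_mono2') (auto simp: add_pos_nonneg power_mono)
  moreover have "((1 + \<xi>) powr (2 * \<sigma> - 1) - (1 - \<xi>) powr (2 * \<sigma> - 1)) / \<xi>
      \<le> ((1 + \<eta>) powr (2 * \<sigma> - 1) - (1 - \<eta>) powr (2 * \<sigma> - 1)) / \<eta>"
    using s1 s2 x y by (intro powr_odd_part_over_id_mono) auto
  ultimately have G: "G \<eta> \<le> G \<xi>"
    unfolding G_def using s1 by (intro mult_left_mono) auto
  have "0 < t\<^sup>2" "t\<^sup>2 < 1" using t by (auto simp: power_less_one_iff)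
  have "F t \<ge> 0"
  proof (rule ccontr)
    assume "\<not> F t \<ge> 0"
    then have "\<not> 0 \<le> G \<xi>" "\<not> G \<eta> \<le> 0"
      using e1 e2 \<open>0 < t\<^sup>2\<close> \<open>t\<^sup>2 < 1\<close> mult_nonneg_nonneg[of "t\<^sup>2" "G \<xi>"]
        mult_nonneg_nonpos[of "1 - t\<^sup>2" "G \<eta>"] by auto
    with G show False by simp
  qed
  then show ?thesis using t by (simp add: F_def)
qed

text \<open>
  This is the previous inequality in homogeneous form, with
  \<open>sqrt A = h * (1 + t)\<close> and \<open>sqrt B = h * (1 - t)\<close>.
\<close>

lemma powr_add_le_powr_three_terms:
  fixes \<sigma> A B :: real
  assumes \<sigma>: "3 powr \<sigma> = 2" and A: "0 < A" and B: "0 < B"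
  shows "A powr \<sigma> + B powr \<sigma> \<le> (A + B + sqrt (A * B)) powr \<sigma>"
proof -
  have *: "A powr \<sigma> + B powr \<sigma> \<le> (A + B + sqrt (A * B)) powr \<sigma>"
    if AB: "0 < B" "B \<le> A" for A B :: real
  proof -
    define x y where "x = sqrt A" and "y = sqrt B"
    have xy: "0 < y" "y \<le> x" and sq: "A = x\<^sup>2" "B = y\<^sup>2" using AB by (auto simp: x_def y_def)
    define h t where "h = (x + y) / 2" and "t = (x - y) / (x + y)"
    have h: "0 < h" and t: "0 \<le> t" "t < 1" using xy by (auto simp: h_def t_def)
    have x: "x = h * (1 + t)" and y: "y = h * (1 - t)"
      using xy by (auto simp: h_def t_def field_simps)
    have "A powr \<sigma> = (h\<^sup>2) powr \<sigma> * (1 + t) powr (2 * \<sigma>)"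
      unfolding sq x power_mult_distrib using t h
      by (simp add: powr_mult powr_powr flip: powr_numeral)
    moreover have "B powr \<sigma> = (h\<^sup>2) powr \<sigma> * (1 - t) powr (2 * \<sigma>)"
      unfolding sq y power_mult_distrib using t h
      by (simp add: powr_mult powr_powr flip: powr_numeral)
    moreover have "sqrt (A * B) = x * y"
      using xy by (simp add: sq real_sqrt_mult)
    then have "A + B + sqrt (A * B) = h\<^sup>2 * (3 + t\<^sup>2)"
      unfolding sq by (simp add: x y power2_eq_square algebra_simps)
    then have "(A + B + sqrt (A * B)) powr \<sigma> = (h\<^sup>2) powr \<sigma> * (3 + t\<^sup>2) powr \<sigma>"
      by (simp add: powr_mult)
    ultimately show ?thesis
      using powr_pair_le_unit[OF \<sigma> t] mult_left_mono[of _ _ "(h\<^sup>2) powr \<sigma>"]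
      by (simp add: distrib_left[symmetric])
  qed
  show ?thesis
  proof (cases "B \<le> A")
    case True then show ?thesis using *[of B A] B by simp
  next
    case False then show ?thesis using *[of A B] A by (simp add: algebra_simps)
  qed
qed

lemma powr_add_less:
  fixes x y \<tau> :: real
  assumes "0 < x" "0 < y" "0 < \<tau>" "\<tau> < 1"
  shows "(x + y) powr \<tau> < x powr \<tau> + y powr \<tau>"
proof -
  define u where "u = x / (x + y)"
  have u: "0 < u" "u < 1" using assms by (auto simp: u_def)
  have "u powr 1 < u powr \<tau>" using u assms powr_less_mono'[of u \<tau> 1] by blast
  moreover have "(1 - u) powr 1 < (1 - u) powr \<tau>" using u assms powr_less_mono'[of "1 - u" \<tau> 1] by simp
  ultimately have "1 < u powr \<tau> + (1 - u) powr \<tau>" using u by simp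
  then have "(x + y) powr \<tau> * 1 < (x + y) powr \<tau> * (u powr \<tau> + (1 - u) powr \<tau>)"
    using assms by (intro mult_strict_left_mono) auto
  also have "\<dots> = ((x + y) * u) powr \<tau> + ((x + y) * (1 - u)) powr \<tau>"
    using assms u by (simp add: powr_mult distrib_left)
  also have "(x + y) * u = x"
    using assms by (simp add: u_def)
  also have "(x + y) * (1 - u) = y"
    using assms by (simp add: u_def field_simps)
  finally show ?thesis by simp
qed

text \<open>
  The exponent \<open>\<sigma> = 1 / log 2 3 = log 3 2\<close> is smaller than \<open>1 / q\<close>, so passing to the power
  \<open>\<tau> = q * \<sigma> < 1\<close> of the sides makes the triangle inequality strict.
\<close>

lemma triangle_imp_angle_less:
  fixes A B C q :: real
  assumes q: "0 < q" "q < log 2 3" and pos: "0 < A" "0 < B" "0 < C"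
    and tri: "C powr (1 / q) \<le> A powr (1 / q) + B powr (1 / q)"
  shows "C < A + B + sqrt (A * B)"
proof -
  define \<sigma> where "\<sigma> = 1 / log 2 3"
  have l: "log 2 3 > (0::real)" by simp
  have "\<sigma> = log 3 2" by (simp add: \<sigma>_def log_def)
  then have \<sigma>: "3 powr \<sigma> = 2" by simp
  have s0: "0 < \<sigma>" using l by (simp add: \<sigma>_def)
  define \<tau> where "\<tau> = q * \<sigma>"
  have \<tau>: "0 < \<tau>" "\<tau> < 1" using q l by (auto simp: \<tau>_def \<sigma>_def)
  have e: "X powr \<sigma> = (X powr (1 / q)) powr \<tau>" for X
    using q by (simp add: powr_powr \<tau>_def)
  have "C powr \<sigma> \<le> (A powr (1 / q) + B powr (1 / q)) powr \<tau>"
    unfolding e using tri \<tau> by (intro powr_mono2) auto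
  also have "\<dots> < A powr \<sigma> + B powr \<sigma>"
    unfolding e using pos \<tau> by (intro powr_add_less) auto
  also have "\<dots> \<le> (A + B + sqrt (A * B)) powr \<sigma>"
    using powr_add_le_powr_three_terms[OF \<sigma>] pos by simp
  finally show ?thesis
    using powr_less_cancel2[OF s0, of C "A + B + sqrt (A * B)"] pos by (simp add: add_pos_nonneg)
qed

section \<open>Determinants of small matrices with zero diagonal\<close>

text \<open>
  The determinant of the principal submatrix with indices \<open>i, j, k, l\<close> of a symmetric matrix \<open>r\<close>
  with zero diagonal; it depends only on the three products over the perfect matchings of
  the indices.
\<close>
definition hollow_minor4 :: "(nat \<Rightarrow> nat \<Rightarrow> real) \<Rightarrow> nat \<Rightarrow> nat \<Rightarrow> nat \<Rightarrow> nat \<Rightarrow> real" where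
  "hollow_minor4 r i j k l =
     (let A = r i j * r k l; B = r i k * r j l; C = r i l * r j k
      in A\<^sup>2 + B\<^sup>2 + C\<^sup>2 - 2 * A * B - 2 * A * C - 2 * B * C)"

text \<open>
  The matrix \<open>x I - M\<close>, where \<open>M\<close> has zero diagonal and off-diagonal entries \<open>r i j\<close>, so that its
  determinant is the characteristic polynomial of \<open>M\<close> at \<open>x\<close>.
\<close>

definition pencil :: "(nat \<Rightarrow> nat \<Rightarrow> real) \<Rightarrow> real \<Rightarrow> real mat" where
  "pencil r x = mat 5 5 (\<lambda>(i, j). if i = j then x else - r i j)"

lemma det_mat_Suc:
  fixes f :: "nat \<times> nat \<Rightarrow> 'a :: comm_ring_1"
  shows "det (mat (Suc n) (Suc n) f) = (\<Sum>j<Suc n. f (0, j) * ((-1) ^ j *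
       det (mat n n (\<lambda>(i', j'). f (i' + 1, if j' < j then j' else j' + 1)))))"
proof -
  have "mat_delete (mat (Suc n) (Suc n) f) 0 j
      = mat n n (\<lambda>(i', j'). f (i' + 1, if j' < j then j' else j' + 1))" for j
    by (rule eq_matI) (auto simp: mat_delete_def)
  then show ?thesis
    by (subst laplace_expansion_row[where n = "Suc n" and i = 0])
      (auto simp: cofactor_def simp del: sum.lessThan_Suc intro!: sum.cong)
qed

lemma det_mat_1: "det (mat 1 1 f) = (f (0, 0) :: 'a :: comm_ring_1)"
  by (subst det_single) auto

lemma det_mat_2: "det (mat 2 2 f) = (f (0,0) * f (1,1) - f (0,1) * f (1,0) :: 'a :: comm_ring_1)"
  using det_mat_Suc[of 1 f] by (simp add: det_mat_1[unfolded One_nat_def] numeral_2_eq_2)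

lemma det_mat_3:
  fixes f :: "nat \<times> nat \<Rightarrow> 'a :: comm_ring_1"
  shows "det (mat 3 3 f) = f (0,0) * (f (1,1) * f (2,2) - f (1,2) * f (2,1))
     - f (0,1) * (f (1,0) * f (2,2) - f (1,2) * f (2,0))
     + f (0,2) * (f (1,0) * f (2,1) - f (1,1) * f (2,0))"
proof -
  have 3: "{..<3} = {0, 1, 2 :: nat}" by auto
  have s: "Suc 2 = 3" by simp
  show ?thesis
    using det_mat_Suc[of 2 f] unfolding s 3 det_mat_2 by (simp add: algebra_simps del: One_nat_def)
qed

lemma det_mat_4:
  fixes f :: "nat \<times> nat \<Rightarrow> 'a :: comm_ring_1"
  shows "det (mat 4 4 f) =
       f (0,0) * det (mat 3 3 (\<lambda>(i, j). f (i + 1, j + 1)))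
     - f (0,1) * det (mat 3 3 (\<lambda>(i, j). f (i + 1, if j < 1 then j else j + 1)))
     + f (0,2) * det (mat 3 3 (\<lambda>(i, j). f (i + 1, if j < 2 then j else j + 1)))
     - f (0,3) * det (mat 3 3 (\<lambda>(i, j). f (i + 1, if j < 3 then j else j + 1)))"
proof -
  have 4: "{..<4} = {0, 1, 2, 3 :: nat}" by auto
  have s: "Suc 3 = 4" by simp
  show ?thesis
    using det_mat_Suc[of 3 f] unfolding s 4 by (simp del: One_nat_def)
qed

lemma det_mat_5:
  fixes f :: "nat \<times> nat \<Rightarrow> 'a :: comm_ring_1"
  shows "det (mat 5 5 f) =
       f (0,0) * det (mat 4 4 (\<lambda>(i, j). f (i + 1, j + 1)))
     - f (0,1) * det (mat 4 4 (\<lambda>(i, j). f (i + 1, if j < 1 then j else j + 1)))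
     + f (0,2) * det (mat 4 4 (\<lambda>(i, j). f (i + 1, if j < 2 then j else j + 1)))
     - f (0,3) * det (mat 4 4 (\<lambda>(i, j). f (i + 1, if j < 3 then j else j + 1)))
     + f (0,4) * det (mat 4 4 (\<lambda>(i, j). f (i + 1, if j < 4 then j else j + 1)))"
proof -
  have 5: "{..<5} = {0, 1, 2, 3, 4 :: nat}" by auto
  have s: "Suc 4 = 5" by simp
  show ?thesis
    using det_mat_Suc[of 4 f] unfolding s 5 by (simp del: One_nat_def)
qed

text \<open>
  The coefficients are, up to sign, the sums of the principal minors of each order.
\<close>

lemma det_pencil:
  assumes sym: "\<And>i j. r i j = r j i"
  shows "det (pencil r x) = x ^ 5
    - ((r 0 1)\<^sup>2 + (r 0 2)\<^sup>2 + (r 0 3)\<^sup>2 + (r 0 4)\<^sup>2 + (r 1 2)\<^sup>2 + (r 1 3)\<^sup>2 + (r 1 4)\<^sup>2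
       + (r 2 3)\<^sup>2 + (r 2 4)\<^sup>2 + (r 3 4)\<^sup>2) * x ^ 3
    - 2 * (r 0 1 * r 0 2 * r 1 2 + r 0 1 * r 0 3 * r 1 3 + r 0 1 * r 0 4 * r 1 4
       + r 0 2 * r 0 3 * r 2 3 + r 0 2 * r 0 4 * r 2 4 + r 0 3 * r 0 4 * r 3 4
       + r 1 2 * r 1 3 * r 2 3 + r 1 2 * r 1 4 * r 2 4 + r 1 3 * r 1 4 * r 3 4
       + r 2 3 * r 2 4 * r 3 4) * x\<^sup>2
    + (hollow_minor4 r 1 2 3 4 + hollow_minor4 r 0 2 3 4 + hollow_minor4 r 0 1 3 4
         + hollow_minor4 r 0 1 2 4 + hollow_minor4 r 0 1 2 3) * x
    + det (pencil r 0)"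
proof -
  have s: "r 1 0 = r 0 1" "r 2 0 = r 0 2" "r 3 0 = r 0 3" "r 4 0 = r 0 4" "r 2 1 = r 1 2"
    "r 3 1 = r 1 3" "r 4 1 = r 1 4" "r 3 2 = r 2 3" "r 4 2 = r 2 4" "r 4 3 = r 3 4"
    by (rule sym)+
  have "x ^ 5 = x * x * x * x * x" "x ^ 3 = x * x * x" "x\<^sup>2 = x * x"
    by (simp_all add: eval_nat_numeral)
  note x = this
  show ?thesis
    unfolding pencil_def hollow_minor4_def Let_def det_mat_5 det_mat_4 det_mat_3 prod.case x
    by (simp add: s del: One_nat_def)
      (simp add: algebra_simps power2_eq_square del: One_nat_def)
qed

section \<open>Angles below 120 degrees and the sign of the determinant\<close>

text \<open>
  Label the five indices \<open>a, b, 1, 2, 3\<close>, let \<open>p\<close> be the entry at \<open>(a, b)\<close>, \<open>\<alpha>\<close> and \<open>\<beta>\<close> the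
  entries in the rows \<open>a\<close> and \<open>b\<close>, and \<open>s\<close> the remaining entries.  The assumption \<open>rows\<close> says that
  the rows \<open>a\<close> and \<open>b\<close> annihilate the vector \<open>(wa, wb, w1, w2, w3)\<close>, and the conclusion bounds the
  quadratic form at this vector.  Up to a positive factor, the form is formally minus the squared length of
  a combination with coefficients \<open>w1, w2, w3\<close> of three vectors of squared lengths \<open>\<alpha>k * \<beta>k\<close>
  whose pairwise angles are less than 120 degrees.
\<close>

lemma quadratic_form_neg_of_angles_lt_120:
  fixes p :: real
  assumes p: "0 < p"
    and \<alpha>: "0 < \<alpha>1" "0 < \<alpha>2" "0 < \<alpha>3" and \<beta>: "0 < \<beta>1" "0 < \<beta>2" "0 < \<beta>3"
    and s12: "p * s12 < \<alpha>1 * \<beta>2 + \<alpha>2 * \<beta>1 + sqrt ((\<alpha>1 * \<beta>2) * (\<alpha>2 * \<beta>1))"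
    and s13: "p * s13 < \<alpha>1 * \<beta>3 + \<alpha>3 * \<beta>1 + sqrt ((\<alpha>1 * \<beta>3) * (\<alpha>3 * \<beta>1))"
    and s23: "p * s23 < \<alpha>2 * \<beta>3 + \<alpha>3 * \<beta>2 + sqrt ((\<alpha>2 * \<beta>3) * (\<alpha>3 * \<beta>2))"
    and w: "0 \<le> w1" "0 \<le> w2" "0 \<le> w3" "0 < w1 \<or> 0 < w2 \<or> 0 < w3"
    and rows: "p * wb + \<alpha>1 * w1 + \<alpha>2 * w2 + \<alpha>3 * w3 = 0"
      "p * wa + \<beta>1 * w1 + \<beta>2 * w2 + \<beta>3 * w3 = 0"
  shows "w1 * (\<alpha>1 * wa + \<beta>1 * wb + s12 * w2 + s13 * w3)
       + w2 * (\<alpha>2 * wa + \<beta>2 * wb + s12 * w1 + s23 * w3)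
       + w3 * (\<alpha>3 * wa + \<beta>3 * wb + s13 * w1 + s23 * w2) < 0" (is "?Q < 0")
proof -
  \<comment> \<open>With \<open>g\<close> for the scaled coefficients, \<open>T\<close> is the slack that the angle condition leaves at a pair.\<close>
  define g where "g a b x = sqrt (a * b) * x" for a b x :: real
  define T where "T a b c d s x y = g a b x * g c d y - (p * s - a * d - c * b) * (x * y)"
    for a b c d s x y
  have sq: "(g a b x)\<^sup>2 = a * b * x\<^sup>2" if "0 < a" "0 < b" for a b x
    using that by (simp add: g_def power_mult_distrib)
  have T: "T a b c d s x y = (a * d + c * b + sqrt ((a * d) * (c * b)) - p * s) * (x * y)"
    if "0 < a" "0 < b" "0 < c" "0 < d" for a b c d s x y
    by (simp add: T_def g_def real_sqrt_mult algebra_simps)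
  have T0: "0 \<le> T a b c d s x y"
    if "0 < a" "0 < b" "0 < c" "0 < d" "0 \<le> x" "0 \<le> y"
      "p * s < a * d + c * b + sqrt ((a * d) * (c * b))" for a b c d s x y
    using that by (simp add: T)
  have Tpos: "0 < T a b c d s x y"
    if "0 < a" "0 < b" "0 < c" "0 < d" "0 < x" "0 < y"
      "p * s < a * d + c * b + sqrt ((a * d) * (c * b))" for a b c d s x y
    using that by (simp add: T)
  define g1 g2 g3 where "g1 = g \<alpha>1 \<beta>1 w1" and "g2 = g \<alpha>2 \<beta>2 w2" and "g3 = g \<alpha>3 \<beta>3 w3"
  define T12 T13 T23 where "T12 = T \<alpha>1 \<beta>1 \<alpha>2 \<beta>2 s12 w1 w2"
    and "T13 = T \<alpha>1 \<beta>1 \<alpha>3 \<beta>3 s13 w1 w3" and "T23 = T \<alpha>2 \<beta>2 \<alpha>3 \<beta>3 s23 w2 w3"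
  note defs = g1_def g2_def g3_def T12_def T13_def T23_def
  have wb: "p * wb = - (\<alpha>1 * w1 + \<alpha>2 * w2 + \<alpha>3 * w3)"
    and wa: "p * wa = - (\<beta>1 * w1 + \<beta>2 * w2 + \<beta>3 * w3)"
    using rows by simp_all
  have "p * ?Q = (w1 * \<alpha>1 + w2 * \<alpha>2 + w3 * \<alpha>3) * (p * wa) + (w1 * \<beta>1 + w2 * \<beta>2 + w3 * \<beta>3) * (p * wb)
      + 2 * p * (s12 * w1 * w2 + s13 * w1 * w3 + s23 * w2 * w3)"
    by (simp add: algebra_simps)
  also have "\<dots> = - (2 * (g1\<^sup>2 + g2\<^sup>2 + g3\<^sup>2) - 2 * (g1 * g2 + g1 * g3 + g2 * g3))
      - 2 * (T12 + T13 + T23)"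
    unfolding wa wb
    by (simp add: defs sq \<alpha> \<beta> T_def) (simp add: algebra_simps power2_eq_square)
  also have "\<dots> = - ((g1 - g2)\<^sup>2 + (g1 - g3)\<^sup>2 + (g2 - g3)\<^sup>2) - 2 * (T12 + T13 + T23)"
    by (simp add: algebra_simps power2_eq_square)
  finally have Q: "p * ?Q = \<dots>" .
  have T_nonneg: "0 \<le> T12" "0 \<le> T13" "0 \<le> T23"
    using T0 \<alpha> \<beta> w s12 s13 s23 by (auto simp: defs)
  have "0 < (g1 - g2)\<^sup>2 + (g1 - g3)\<^sup>2 + (g2 - g3)\<^sup>2 + 2 * (T12 + T13 + T23)"
  proof (cases "g1 = g2 \<and> g1 = g3")
    case True
    have pos_iff: "0 < g a b x \<longleftrightarrow> 0 < x" if "0 < a" "0 < b" for a b x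
      using that by (metis g_def mult_pos_pos real_sqrt_gt_zero zero_less_mult_pos)
    have "0 < w1" "0 < w2"
      using True w(4) pos_iff[OF \<alpha>(1) \<beta>(1)] pos_iff[OF \<alpha>(2) \<beta>(2)] pos_iff[OF \<alpha>(3) \<beta>(3)]
      by (metis g1_def g2_def g3_def)+
    then have "0 < T12" using Tpos \<alpha> \<beta> s12 by (simp add: T12_def)
    with T_nonneg True show ?thesis by auto
  next
    case False
    then have "0 < (g1 - g2)\<^sup>2 \<or> 0 < (g1 - g3)\<^sup>2" by auto
    moreover have "0 < x + y + z + 2 * (a + b + c)"
      if "0 < x \<or> 0 < y" "0 \<le> x" "0 \<le> y" "0 \<le> z" "0 \<le> a" "0 \<le> b" "0 \<le> c" for x y z a b c :: real
      using that by auto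
    ultimately show ?thesis using T_nonneg by simp
  qed
  then have "p * ?Q < 0" unfolding Q by simp
  then show ?thesis using p by (simp add: mult_less_0_iff)
qed

text \<open>
  The matrix with zero diagonal and off-diagonal entries \<open>r i j\<close>; indices start at \<open>0\<close>.
\<close>

definition hollow_mat :: "nat \<Rightarrow> (nat \<Rightarrow> nat \<Rightarrow> real) \<Rightarrow> real mat" where
  "hollow_mat n r = mat n n (\<lambda>(i, j). if i = j then 0 else r i j)"

text \<open>
  A symmetric array with positive off-diagonal entries such that, for any four indices, the
  triangle with squared sides \<open>r i j * r k l\<close>, \<open>r i k * r j l\<close>, \<open>r i l * r j k\<close> has all angles
  less than 120 degrees.  The law of cosines turns the bound on the angle opposite to the first
  side into the last inequality, and permuting the indices covers the other two angles.
\<close>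

definition angles_lt_120 :: "nat \<Rightarrow> (nat \<Rightarrow> nat \<Rightarrow> real) \<Rightarrow> bool" where
  "angles_lt_120 n r \<longleftrightarrow>
     (\<forall>i j. r i j = r j i) \<and> (\<forall>i<n. \<forall>j<n. i \<noteq> j \<longrightarrow> 0 < r i j) \<and>
     (\<forall>i<n. \<forall>j<n. \<forall>k<n. \<forall>l<n. distinct [i, j, k, l] \<longrightarrow>
        r i j * r k l < r i k * r j l + r i l * r j k + sqrt ((r i k * r j l) * (r i l * r j k)))"

lemma angles_lt_120D:
  assumes "angles_lt_120 n r"
  shows "r i j = r j i"
    and "i < n \<Longrightarrow> j < n \<Longrightarrow> i \<noteq> j \<Longrightarrow> 0 < r i j"
    and "i < n \<Longrightarrow> j < n \<Longrightarrow> k < n \<Longrightarrow> l < n \<Longrightarrow> distinct [i, j, k, l] \<Longrightarrow>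
        r i j * r k l < r i k * r j l + r i l * r j k + sqrt ((r i k * r j l) * (r i l * r j k))"
  using assms unfolding angles_lt_120_def by blast+

text \<open>
  The negative of the minor is Heron's product of the triangle with squared sides
  \<open>r i j * r k l\<close>, \<open>r i k * r j l\<close>, \<open>r i l * r j k\<close>.
\<close>

lemma hollow_minor4_neg:
  assumes "angles_lt_120 n r" and lt: "i < n" "j < n" "k < n" "l < n" and d: "distinct [i, j, k, l]"
  shows "hollow_minor4 r i j k l < 0"
proof -
  define x y z where "x = sqrt (r i j * r k l)" and "y = sqrt (r i k * r j l)"
    and "z = sqrt (r i l * r j k)"
  have pos: "0 < r i j * r k l" "0 < r i k * r j l" "0 < r i l * r j k"
    using angles_lt_120D(2)[OF assms(1)] lt d by auto
  then have xyz: "0 < x" "0 < y" "0 < z"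
    and sq: "r i j * r k l = x\<^sup>2" "r i k * r j l = y\<^sup>2" "r i l * r j k = z\<^sup>2"
    by (simp_all add: x_def y_def z_def)
  have S: "sqrt (u\<^sup>2 * v\<^sup>2) = u * v" if "0 < u" "0 < v" for u v :: real
    using that by (simp add: real_sqrt_mult)
  have lt_add: "u < v + w" if "u\<^sup>2 < v\<^sup>2 + w\<^sup>2 + v * w" "0 < v" "0 < w" for u v w :: real
  proof (rule power2_less_imp_less)
    have "0 < v * w" using that by simp
    then show "u\<^sup>2 < (v + w)\<^sup>2" using that(1) by (simp add: power2_sum)
  qed (use that in simp)
  note sym = angles_lt_120D(1)[OF assms(1)]
  have "x\<^sup>2 < y\<^sup>2 + z\<^sup>2 + y * z"
    using angles_lt_120D(3)[OF assms(1) lt d] xyz by (simp add: sq S)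
  then have "x < y + z" by (rule lt_add[OF _ xyz(2,3)])
  moreover have "y\<^sup>2 < x\<^sup>2 + z\<^sup>2 + x * z"
    using angles_lt_120D(3)[OF assms(1), of i k j l] lt d xyz sym[of k j] by (auto simp: sq S)
  then have "y < x + z" by (rule lt_add[OF _ xyz(1,3)])
  moreover have "z\<^sup>2 < x\<^sup>2 + y\<^sup>2 + x * y"
    using angles_lt_120D(3)[OF assms(1), of i l j k] lt d xyz sym[of l j] sym[of l k] by (auto simp: sq S)
  then have "z < x + y" by (rule lt_add[OF _ xyz(1,2)])
  ultimately have "0 < (x + y + z) * ((y + z - x) * (x + z - y) * (x + y - z))"
    using xyz by (intro mult_pos_pos) auto
  moreover have "hollow_minor4 r i j k l = - ((x + y + z) * ((y + z - x) * (x + z - y) * (x + y - z)))"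
    unfolding hollow_minor4_def Let_def sq by (simp add: algebra_simps power2_eq_square)
  ultimately show ?thesis by simp
qed

text \<open>
  Here \<open>C\<close> stands for the cofactor matrix of \<open>hollow_mat 5 r\<close> and \<open>D\<close> for the determinant.  If
  \<open>D \<le> 0\<close>, then for each \<open>i\<close> there is exactly one \<open>j \<noteq> i\<close> with \<open>C i j \<le> 0\<close>, so that five indices
  are perfectly matched.
\<close>

lemma det_pos_of_cofactor_relations:
  fixes r C :: "nat \<Rightarrow> nat \<Rightarrow> real"
  assumes r: "angles_lt_120 5 r"
    and Csym: "\<And>i j. i < 5 \<Longrightarrow> j < 5 \<Longrightarrow> C i j = C j i"
    and Cneg: "\<And>i. i < 5 \<Longrightarrow> C i i < 0"
    and rows: "\<And>a i. a < 5 \<Longrightarrow> i < 5 \<Longrightarrow>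
        (\<Sum>k<5. (if a = k then 0 else r a k) * C i k) = (if a = i then D else 0)"
  shows "0 < D"
proof (rule ccontr)
  assume "\<not> 0 < D"
  then have D: "D \<le> 0" by simp
  note sym = angles_lt_120D(1)[OF r] and pos = angles_lt_120D(2)[OF r] and angle = angles_lt_120D(3)[OF r]
  have all_five: "{..<5} = {i, j, k, a, b}"
    if "i < 5" "j < 5" "k < 5" "a < 5" "b < 5" and d: "distinct [i, j, k, a, b]" for i j k a b :: nat
  proof -
    have "card {i, j, k, a, b} = 5" using d by simp
    then show ?thesis using that card_subset_eq[of "{..<5}" "{i, j, k, a, b}"] by simp
  qed
  \<comment> \<open>The vector \<open>- C i\<close> has value \<open>C i i * D \<ge> 0\<close> under the form and is annihilated by all rows but \<open>i\<close>.\<close>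
  have most: "\<not> (C i j \<le> 0 \<and> C i k \<le> 0)"
    if lt: "i < 5" "j < 5" "k < 5" "a < 5" "b < 5" and d: "distinct [i, j, k, a, b]" for i j k a b
  proof
    assume C: "C i j \<le> 0 \<and> C i k \<le> 0"
    have I: "{..<5} = {i, j, k, a, b}" by (rule all_five[OF lt d])
    note row = rows[OF _ lt(1), unfolded I]
    have ri: "r i j * C i j + r i k * C i k + r i a * C i a + r i b * C i b = D"
      and rj: "r i j * C i i + r j k * C i k + r j a * C i a + r j b * C i b = 0"
      and rk: "r i k * C i i + r j k * C i j + r k a * C i a + r k b * C i b = 0"
      and ra: "r i a * C i i + r j a * C i j + r k a * C i k + r a b * C i b = 0"
      and rb: "r i b * C i i + r j b * C i j + r k b * C i k + r a b * C i a = 0"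
      using row[OF lt(1)] row[OF lt(2)] row[OF lt(3)] row[OF lt(4)] row[OF lt(5)] d
        sym[of j i] sym[of k i] sym[of k j] sym[of a i] sym[of a j] sym[of a k]
        sym[of b i] sym[of b j] sym[of b k] sym[of b a]
      by (auto simp: algebra_simps)
    have "(- C i i) * (r i a * (- C i a) + r i b * (- C i b) + r i j * (- C i j) + r i k * (- C i k))
        + (- C i j) * (r j a * (- C i a) + r j b * (- C i b) + r i j * (- C i i) + r j k * (- C i k))
        + (- C i k) * (r k a * (- C i a) + r k b * (- C i b) + r i k * (- C i i) + r j k * (- C i j))
        < 0"
    proof (rule quadratic_form_neg_of_angles_lt_120[where p = "r a b"])
      show "r a b * r i j < r i a * r j b + r j a * r i b + sqrt (r i a * r j b * (r j a * r i b))"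
        using angle[OF lt(4,5) lt(1,2)] d
          sym[of a i] sym[of a j] sym[of b i] sym[of b j] by (auto simp: algebra_simps)
      show "r a b * r i k < r i a * r k b + r k a * r i b + sqrt (r i a * r k b * (r k a * r i b))"
        using angle[OF lt(4,5) lt(1,3)] d
          sym[of a i] sym[of a k] sym[of b i] sym[of b k] by (auto simp: algebra_simps)
      show "r a b * r j k < r j a * r k b + r k a * r j b + sqrt (r j a * r k b * (r k a * r j b))"
        using angle[OF lt(4,5) lt(2,3)] d
          sym[of a j] sym[of a k] sym[of b j] sym[of b k] by (auto simp: algebra_simps)
      show "r a b * (- C i b) + r i a * (- C i i) + r j a * (- C i j) + r k a * (- C i k) = 0"
        using ra by simp
      show "r a b * (- C i a) + r i b * (- C i i) + r j b * (- C i j) + r k b * (- C i k) = 0"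
        using rb by simp
    qed (use pos[OF lt(4) lt(5)] pos[OF lt(1) lt(4)] pos[OF lt(2) lt(4)] pos[OF lt(3) lt(4)]
          pos[OF lt(1) lt(5)] pos[OF lt(2) lt(5)] pos[OF lt(3) lt(5)] d C Cneg[OF lt(1)] in auto)
    moreover have "r i a * (- C i a) + r i b * (- C i b) + r i j * (- C i j) + r i k * (- C i k) = - D"
      using ri by (simp add: algebra_simps)
    moreover have "r j a * (- C i a) + r j b * (- C i b) + r i j * (- C i i) + r j k * (- C i k) = 0"
      using rj by (simp add: algebra_simps)
    moreover have "r k a * (- C i a) + r k b * (- C i b) + r i k * (- C i i) + r j k * (- C i j) = 0"
      using rk by (simp add: algebra_simps)
    ultimately have "C i i * D < 0" by simp
    then show False using Cneg[OF lt(1)] D by (simp add: mult_less_0_iff)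
  qed
  \<comment> \<open>Otherwise row \<open>i\<close> would make \<open>D\<close> a sum of positive terms.\<close>
  have least: "C i j \<le> 0 \<or> C i k \<le> 0 \<or> C i a \<le> 0 \<or> C i b \<le> 0"
    if lt: "i < 5" "j < 5" "k < 5" "a < 5" "b < 5" and d: "distinct [i, j, k, a, b]" for i j k a b
  proof (rule ccontr)
    assume neg: "\<not> ?thesis"
    have I: "{..<5} = {i, j, k, a, b}" by (rule all_five[OF lt d])
    have "r i j * C i j + r i k * C i k + r i a * C i a + r i b * C i b = D"
      using rows[OF lt(1) lt(1), unfolded I] d by auto
    moreover have "0 < r i j * C i j" "0 < r i k * C i k" "0 < r i a * C i a" "0 < r i b * C i b"
      using neg pos[OF lt(1) lt(2)] pos[OF lt(1) lt(3)] pos[OF lt(1) lt(4)] pos[OF lt(1) lt(5)] d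
      by auto
    ultimately show False using D by linarith
  qed
  define N where "N i j \<longleftrightarrow> C i j \<le> 0" for i j
  have sN: "N 1 0 = N 0 1" "N 2 0 = N 0 2" "N 3 0 = N 0 3" "N 4 0 = N 0 4" "N 2 1 = N 1 2"
    "N 3 1 = N 1 3" "N 4 1 = N 1 4" "N 3 2 = N 2 3" "N 4 2 = N 2 4" "N 4 3 = N 3 4"
    unfolding N_def using Csym by (auto simp del: One_nat_def)
  have N: "N i j \<or> N i k \<or> N i a \<or> N i b"
      "\<not> (N i j \<and> N i k)" "\<not> (N i j \<and> N i a)" "\<not> (N i j \<and> N i b)"
      "\<not> (N i k \<and> N i a)" "\<not> (N i k \<and> N i b)" "\<not> (N i a \<and> N i b)"
    if "i < 5" "j < 5" "k < 5" "a < 5" "b < 5" and d: "distinct [i, j, k, a, b]" for i j k a b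
    using least[OF that] most[of i j k a b] most[of i j a k b] most[of i j b k a]
      most[of i k a j b] most[of i k b j a] most[of i a b j k] that
    unfolding N_def by auto
  have N0: "N 0 1 \<or> N 0 2 \<or> N 0 3 \<or> N 0 4" "\<not> (N 0 1 \<and> N 0 2)" "\<not> (N 0 1 \<and> N 0 3)"
      "\<not> (N 0 1 \<and> N 0 4)" "\<not> (N 0 2 \<and> N 0 3)" "\<not> (N 0 2 \<and> N 0 4)" "\<not> (N 0 3 \<and> N 0 4)"
    using N[of 0 1 2 3 4] by simp_all
  have N1: "N 0 1 \<or> N 1 2 \<or> N 1 3 \<or> N 1 4" "\<not> (N 0 1 \<and> N 1 2)" "\<not> (N 0 1 \<and> N 1 3)"
      "\<not> (N 0 1 \<and> N 1 4)" "\<not> (N 1 2 \<and> N 1 3)" "\<not> (N 1 2 \<and> N 1 4)" "\<not> (N 1 3 \<and> N 1 4)"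
    using N[of 1 0 2 3 4] unfolding sN by simp_all
  have N2: "N 0 2 \<or> N 1 2 \<or> N 2 3 \<or> N 2 4" "\<not> (N 0 2 \<and> N 1 2)" "\<not> (N 0 2 \<and> N 2 3)"
      "\<not> (N 0 2 \<and> N 2 4)" "\<not> (N 1 2 \<and> N 2 3)" "\<not> (N 1 2 \<and> N 2 4)" "\<not> (N 2 3 \<and> N 2 4)"
    using N[of 2 0 1 3 4] unfolding sN by simp_all
  have N3: "N 0 3 \<or> N 1 3 \<or> N 2 3 \<or> N 3 4" "\<not> (N 0 3 \<and> N 1 3)" "\<not> (N 0 3 \<and> N 2 3)"
      "\<not> (N 0 3 \<and> N 3 4)" "\<not> (N 1 3 \<and> N 2 3)" "\<not> (N 1 3 \<and> N 3 4)" "\<not> (N 2 3 \<and> N 3 4)"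
    using N[of 3 0 1 2 4] unfolding sN by simp_all
  have N4: "N 0 4 \<or> N 1 4 \<or> N 2 4 \<or> N 3 4" "\<not> (N 0 4 \<and> N 1 4)" "\<not> (N 0 4 \<and> N 2 4)"
      "\<not> (N 0 4 \<and> N 3 4)" "\<not> (N 1 4 \<and> N 2 4)" "\<not> (N 1 4 \<and> N 3 4)" "\<not> (N 2 4 \<and> N 3 4)"
    using N[of 4 0 1 2 3] unfolding sN by simp_all
  \<comment> \<open>There is no perfect matching of five points.\<close>
  show False
    using N0 N1 N2 N3 N4 by satx
qed

section \<open>Signature from the characteristic polynomial\<close>

text \<open>
  For an eigenvector \<open>v\<close>, the number \<open>S = v\<^sup>* A v\<close> is invariant under conjugation and equals
  \<open>z\<close> times the squared norm of \<open>v\<close>.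
\<close>

lemma eigenvalue_real_symmetric_is_real:
  assumes A: "A \<in> carrier_mat n n" and sym: "transpose_mat A = A"
    and ev: "eigenvalue (map_mat complex_of_real A) z"
  shows "z \<in> \<real>"
proof -
  obtain v where v: "v \<in> carrier_vec n" "v \<noteq> 0\<^sub>v n"
    and Av: "map_mat complex_of_real A *\<^sub>v v = z \<cdot>\<^sub>v v"
    using ev A unfolding eigenvalue_def eigenvector_def by auto
  have sA: "A $$ (i, j) = A $$ (j, i)" if "i < n" "j < n" for i j
    using sym A that by (metis index_transpose_mat(1) carrier_matD)
  have row: "(\<Sum>j<n. of_real (A $$ (i, j)) * v $ j) = z * v $ i" if "i < n" for i
  proof -
    have "(map_mat complex_of_real A *\<^sub>v v) $ i = (z \<cdot>\<^sub>v v) $ i" using Av by simp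
    then show ?thesis using that A v
      by (simp add: scalar_prod_def lessThan_atLeast0)
  qed
  define N where "N = (\<Sum>i<n. (cmod (v $ i))\<^sup>2)"
  define S where "S = (\<Sum>i<n. cnj (v $ i) * (\<Sum>j<n. of_real (A $$ (i, j)) * v $ j))"
  have "S = (\<Sum>i<n. cnj (v $ i) * (z * v $ i))"
    unfolding S_def by (intro sum.cong) (simp_all add: row)
  also have "\<dots> = z * of_real N"
    unfolding N_def of_real_sum complex_norm_square sum_distrib_left
    by (simp add: mult_ac)
  finally have S: "S = z * of_real N" .
  have "cnj S = (\<Sum>i<n. \<Sum>j<n. v $ i * (of_real (A $$ (i, j)) * cnj (v $ j)))"
    by (simp add: S_def sum_distrib_left)
  also have "\<dots> = (\<Sum>j<n. \<Sum>i<n. v $ i * (of_real (A $$ (i, j)) * cnj (v $ j)))"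
    by (rule sum.swap)
  also have "\<dots> = S"
    unfolding S_def sum_distrib_left
    by (intro sum.cong refl) (use sA in \<open>auto simp: algebra_simps\<close>)
  finally have "cnj z * of_real N = z * of_real N" unfolding S by simp
  moreover have "N \<noteq> 0"
  proof
    assume "N = 0"
    then have "\<forall>i\<in>{..<n}. (cmod (v $ i))\<^sup>2 = 0"
      unfolding N_def by (subst (asm) sum_nonneg_eq_0_iff) auto
    then have "v = 0\<^sub>v n" using v(1) by (intro eq_vecI) auto
    with v(2) show False by simp
  qed
  ultimately show ?thesis by (simp add: Reals_cnj_iff)
qed

lemma char_poly_real_symmetric_splits:
  fixes A :: "real mat"
  assumes A: "A \<in> carrier_mat n n" and sym: "transpose_mat A = A"
  shows "\<exists>as. length as = n \<and> char_poly A = (\<Prod>a\<leftarrow>as. [:- a, 1:])"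
proof -
  interpret h: map_poly_inj_idom_hom complex_of_real ..
  let ?cA = "map_mat complex_of_real A"
  have cA: "?cA \<in> carrier_mat n n" using A by simp
  obtain zs where zs: "char_poly ?cA = (\<Prod>a\<leftarrow>zs. [:- a, 1:])" "length zs = n"
    using char_poly_factorized[OF cA] by blast
  have real: "z \<in> \<real>" if "z \<in> set zs" for z
  proof -
    have "poly (char_poly ?cA) z = 0"
      unfolding zs(1) using that by (auto simp: poly_prod_list prod_list_zero_iff)
    then have "eigenvalue ?cA z" using eigenvalue_root_char_poly[OF cA] by simp
    then show ?thesis by (rule eigenvalue_real_symmetric_is_real[OF A sym])
  qed
  define as where "as = map Re zs"
  have zs_as: "zs = map complex_of_real as"
    unfolding as_def map_map o_def
    by (rule map_idI[symmetric]) (simp add: real of_real_Re)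
  have "map_poly complex_of_real (char_poly A) = char_poly ?cA"
    by (rule of_real_hom.char_poly_hom[OF A, symmetric])
  also have "\<dots> = (\<Prod>a\<leftarrow>as. [:- complex_of_real a, 1:])"
    unfolding zs(1) zs_as map_map o_def ..
  also have "\<dots> = map_poly complex_of_real (\<Prod>a\<leftarrow>as. [:- a, 1:])"
    by (induction as) (simp_all add: h.hom_mult del: mult_pCons_left)
  finally have "char_poly A = (\<Prod>a\<leftarrow>as. [:- a, 1:])"
    by (rule h.injectivity)
  moreover have "length as = n" using zs(2) by (simp add: as_def)
  ultimately show ?thesis by blast
qed

lemma proots_linear_factors: "proots (\<Prod>a\<leftarrow>as. [:- a, 1:]) = mset (as :: real list)"
proof -
  have "(\<Prod>a\<leftarrow>as. [:- a, 1:]) \<noteq> 0" for as :: "real list"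
    by (auto simp: prod_list_zero_iff)
  note nz = this
  show ?thesis
  proof (induction as)
    case (Cons a as)
    then show ?case using proots_mult[OF _ nz, of "[:- a, 1:]" as] by (simp del: mult_pCons_left)
  qed simp
qed

lemma poly_char_poly_0:
  assumes A: "(A :: real mat) \<in> carrier_mat n n"
  shows "poly (char_poly A) 0 = (-1) ^ n * det A"
proof -
  have "poly (char_poly A) 0 = det ((-1) \<cdot>\<^sub>m A)"
    unfolding char_poly_def
    by (rule poly_det_cong[of _ n], insert A, auto simp: char_poly_matrix_def)
  then show ?thesis using A by simp
qed

lemma det_pos_of_signature:
  assumes A: "A \<in> carrier_mat 5 5" and sym: "transpose_mat A = A"
    and P: "size {#x \<in># eigenvalues_mset A. 0 < x#} = 1"
    and N: "size {#x \<in># eigenvalues_mset A. x < 0#} = 4"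
  shows "0 < det A"
proof -
  obtain as where as: "length as = 5" "char_poly A = (\<Prod>a\<leftarrow>as. [:- a, 1:])"
    using char_poly_real_symmetric_splits[OF A sym] by blast
  define P where "P = {#x \<in># mset as. 0 < x#}"
  define N where "N = {#x \<in># mset as. x < 0#}"
  have ev: "eigenvalues_mset A = mset as"
    unfolding eigenvalues_mset_def as(2) by (rule proots_linear_factors)
  obtain a where a: "P = {#a#}"
    using P size_1_singleton_mset unfolding P_def ev by blast
  have Nsize: "size N = 4" using N unfolding N_def ev .
  have sub: "P + N \<subseteq># mset as"
    unfolding P_def N_def by (rule mset_subset_eqI) auto
  have "size (mset as) = size (P + N)" using Nsize a as(1) by simp
  then have eq: "mset as = P + N"
    using sub mset_subset_size subset_mset.less_le by fastforce
  have "poly (char_poly A) 0 = prod_mset (image_mset uminus (mset as))"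
    unfolding as(2) by (simp add: poly_prod_list o_def prod_mset_prod_list flip: mset_map)
  also have "\<dots> = - a * prod_mset (image_mset uminus N)"
    unfolding eq a by simp
  finally have "- det A = - a * prod_mset (image_mset uminus N)"
    by (simp add: poly_char_poly_0[OF A])
  moreover have "0 < a"
  proof -
    have "a \<in># P" by (simp add: a)
    then show ?thesis by (simp add: P_def)
  qed
  moreover have "0 < prod_mset (image_mset uminus M)" if "\<forall>x\<in>#M. x < 0" for M :: "real multiset"
    using that by (induction M) (auto intro: mult_neg_pos)
  then have "0 < prod_mset (image_mset uminus N)" by (simp add: N_def)
  ultimately show ?thesis by simp
qed

lemma hollow_mat_carrier [simp]: "hollow_mat n r \<in> carrier_mat n n"
  by (simp add: hollow_mat_def)

lemma hollow_mat_dim [simp]: "dim_row (hollow_mat n r) = n" "dim_col (hollow_mat n r) = n"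
  by (simp_all add: hollow_mat_def)

lemma hollow_mat_index [simp]:
  "i < n \<Longrightarrow> j < n \<Longrightarrow> hollow_mat n r $$ (i, j) = (if i = j then 0 else r i j)"
  by (simp add: hollow_mat_def)

lemma transpose_hollow_mat:
  assumes "\<And>i j. r i j = r j i"
  shows "transpose_mat (hollow_mat n r) = hollow_mat n r"
  by (rule eq_matI) (auto simp: hollow_mat_def assms)

lemma poly_char_poly_hollow_mat:
  "poly (char_poly (hollow_mat 5 r)) x = det (pencil r x)"
  unfolding char_poly_def
  by (rule poly_det_cong[of _ 5]) (auto simp: char_poly_matrix_def pencil_def hollow_mat_def)

lemma det_hollow_mat_pos:
  assumes r: "angles_lt_120 5 r"
  shows "0 < det (hollow_mat 5 r)"
proof -
  let ?M = "hollow_mat 5 r"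
  have M: "?M \<in> carrier_mat 5 5" by simp
  note sym = angles_lt_120D(1)[OF r]
  have diag: "det (mat_delete ?M i i) = hollow_minor4 r (if 0 < i then 0 else 1) (if 1 < i then 1 else 2)
      (if 2 < i then 2 else 3) (if 3 < i then 3 else 4)" if "i < 5" for i
  proof -
    have "mat_delete ?M i i = mat 4 4 (\<lambda>(a, b). if a = b then 0
        else r (if a < i then a else a + 1) (if b < i then b else b + 1))"
      by (rule eq_matI) (auto simp: mat_delete_def hollow_mat_def)
    moreover have "i = 0 \<or> i = 1 \<or> i = 2 \<or> i = 3 \<or> i = 4" using that by auto
    ultimately show ?thesis
      using sym[of 1 0] sym[of 2 0] sym[of 3 0] sym[of 4 0] sym[of 2 1] sym[of 3 1] sym[of 4 1]
        sym[of 3 2] sym[of 4 2] sym[of 4 3]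
      unfolding hollow_minor4_def Let_def
      by (auto simp: det_mat_4 det_mat_3 algebra_simps power2_eq_square simp del: One_nat_def)
  qed
  show ?thesis
  proof (rule det_pos_of_cofactor_relations[OF r, where C = "cofactor ?M"])
    fix i j :: nat assume ij: "i < 5" "j < 5"
    have "mat_delete ?M j i = transpose_mat (mat_delete ?M i j)"
      using ij by (intro eq_matI) (auto simp: mat_delete_def hollow_mat_def angles_lt_120D(1)[OF r])
    then show "cofactor ?M i j = cofactor ?M j i"
      unfolding cofactor_def
      using det_transpose[of "mat_delete ?M i j" 4] mat_delete_carrier[OF M, of i j] by (simp add: add.commute)
  next
    fix i :: nat assume i: "i < 5"
    then show "cofactor ?M i i < 0"
      unfolding cofactor_def diag[OF i] using hollow_minor4_neg[OF r] by auto
  next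
    fix a i :: nat assume ai: "a < 5" "i < 5"
    have "(\<Sum>k<5. (if a = k then 0 else r a k) * cofactor ?M i k) = (?M * adj_mat ?M) $$ (a, i)"
      using ai by (simp add: scalar_prod_def adj_mat_def lessThan_atLeast0)
    also have "\<dots> = (det ?M \<cdot>\<^sub>m 1\<^sub>m 5) $$ (a, i)"
      using adj_mat(2)[OF M] by simp
    also have "\<dots> = (if a = i then det ?M else 0)" using ai by simp
    finally show "(\<Sum>k<5. (if a = k then 0 else r a k) * cofactor ?M i k) = (if a = i then det ?M else 0)" .
  qed
qed

lemma signature_hollow_mat:
  assumes r: "angles_lt_120 5 r"
  shows "size {#x \<in># eigenvalues_mset (hollow_mat 5 r). 0 < x#} = 1"
    and "size {#x \<in># eigenvalues_mset (hollow_mat 5 r). x < 0#} = 4"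
proof -
  let ?M = "hollow_mat 5 r"
  note sym = angles_lt_120D(1)[OF r] and pos = angles_lt_120D(2)[OF r]
  have M: "?M \<in> carrier_mat 5 5" by simp
  define p where "p = char_poly ?M"
  obtain as where as: "length as = 5" "p = (\<Prod>a\<leftarrow>as. [:- a, 1:])"
    using char_poly_real_symmetric_splits[OF M transpose_hollow_mat[OF sym]] unfolding p_def by blast
  have ev: "eigenvalues_mset ?M = proots p" by (simp add: eigenvalues_mset_def p_def)
  have proots: "proots p = mset as" unfolding as(2) by (rule proots_linear_factors)
  define e where "e = det ?M"
  have e: "0 < e" using det_hollow_mat_pos[OF r] by (simp add: e_def)
  have p0: "poly p 0 = - e" using poly_char_poly_0[OF M] by (simp add: p_def e_def)
  have "\<exists>b c d. 0 < b \<and> 0 < c \<and> 0 < d \<and> (\<forall>x. poly p x = x ^ 5 - b * x ^ 3 - c * x\<^sup>2 - d * x - e)"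
  proof (intro exI conjI allI)
    fix x
    have "det (pencil r 0) = - e"
      using p0 by (simp add: p_def poly_char_poly_hollow_mat)
    then show "poly p x = x ^ 5
      - ((r 0 1)\<^sup>2 + (r 0 2)\<^sup>2 + (r 0 3)\<^sup>2 + (r 0 4)\<^sup>2 + (r 1 2)\<^sup>2 + (r 1 3)\<^sup>2 + (r 1 4)\<^sup>2
         + (r 2 3)\<^sup>2 + (r 2 4)\<^sup>2 + (r 3 4)\<^sup>2) * x ^ 3
      - (2 * (r 0 1 * r 0 2 * r 1 2 + r 0 1 * r 0 3 * r 1 3 + r 0 1 * r 0 4 * r 1 4
         + r 0 2 * r 0 3 * r 2 3 + r 0 2 * r 0 4 * r 2 4 + r 0 3 * r 0 4 * r 3 4
         + r 1 2 * r 1 3 * r 2 3 + r 1 2 * r 1 4 * r 2 4 + r 1 3 * r 1 4 * r 3 4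
         + r 2 3 * r 2 4 * r 3 4)) * x\<^sup>2
      - (- (hollow_minor4 r 1 2 3 4 + hollow_minor4 r 0 2 3 4 + hollow_minor4 r 0 1 3 4
         + hollow_minor4 r 0 1 2 4 + hollow_minor4 r 0 1 2 3)) * x
      - e"
      unfolding p_def poly_char_poly_hollow_mat det_pencil[OF sym, where x = x]
      by (simp add: algebra_simps)
  qed (auto intro!: add_pos_pos mult_pos_pos add_neg_neg hollow_minor4_neg[OF r] pos
        simp: zero_less_power2 less_imp_neq[OF pos, symmetric] simp del: One_nat_def minus_add_distrib)
  then obtain b c d where bcd: "0 < b" "0 < c" "0 < d"
    and p: "\<And>x. poly p x = x ^ 5 - b * x ^ 3 - c * x\<^sup>2 - d * x - e"
    by blast
  have p_poly: "p = [:- e, - d, - c, - b, 0, 1:]"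
    by (rule poly_ext) (simp add: p algebra_simps power2_eq_square power3_eq_cube eval_nat_numeral)
  have "p \<noteq> 0" by (simp add: p_poly)
  \<comment> \<open>Descartes' rule in this case: \<open>x^5\<close> divided by the remaining terms is strictly increasing.\<close>
  have unique: "\<not> x < y" if x: "0 < x" "poly p x = 0" and y: "poly p y = 0" for x y
  proof
    assume xy: "x < y"
    have x5: "x ^ 5 = b * x ^ 3 + c * x\<^sup>2 + d * x + e" and y5: "y ^ 5 = b * y ^ 3 + c * y\<^sup>2 + d * y + e"
      using x y by (simp_all add: p)
    have lt: "x ^ k < y ^ k" if "0 < k" for k using xy x that by (intro power_strict_mono) auto
    have "0 < b * (x * y) ^ 3 * (y\<^sup>2 - x\<^sup>2) + c * (x * y)\<^sup>2 * (y ^ 3 - x ^ 3) + d * (x * y) * (y ^ 4 - x ^ 4)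
        + e * (y ^ 5 - x ^ 5)"
      using bcd e x xy lt by (intro add_pos_pos mult_pos_pos) auto
    also have "\<dots> = y ^ 5 * (b * x ^ 3 + c * x\<^sup>2 + d * x + e) - x ^ 5 * (b * y ^ 3 + c * y\<^sup>2 + d * y + e)"
      by (simp add: algebra_simps eval_nat_numeral)
    also have "\<dots> = 0" unfolding x5[symmetric] y5[symmetric] by simp
    finally show False by simp
  qed
  have "\<exists>a\<in>set as. 0 < a"
  proof (rule ccontr)
    assume "\<not> ?thesis"
    then have "0 \<le> prod_list (map uminus as)" by (intro prod_list_nonneg) auto
    moreover have "poly p 0 = prod_list (map uminus as)"
      unfolding as(2) by (simp add: poly_prod_list o_def)
    ultimately show False using p0 e by simp
  qed
  then obtain a where a: "0 < a" "poly p a = 0"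
    using set_count_proots[OF \<open>p \<noteq> 0\<close>] proots by force
  have a_unique: "x = a" if "0 < x" "poly p x = 0" for x
    using unique[OF that a(2)] unique[OF a that(2)] by simp
  \<comment> \<open>Subtracting \<open>5 * p a = 0\<close> from \<open>a * p' a\<close> leaves only positive terms.\<close>
  have "a * poly (pderiv p) a = 5 * a ^ 5 - 3 * b * a ^ 3 - 2 * c * a\<^sup>2 - d * a"
    by (simp add: p_poly pderiv_pCons algebra_simps eval_nat_numeral)
  also have "\<dots> = 2 * b * a ^ 3 + 3 * c * a\<^sup>2 + 4 * d * a + 5 * e"
    using a(2) by (simp add: p) (simp add: algebra_simps)
  also have "\<dots> > 0" using bcd e a by (intro add_pos_pos) auto
  finally have "poly (pderiv p) a \<noteq> 0" by auto
  then have order: "order a p = 1"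
    using order_pderiv[OF \<open>p \<noteq> 0\<close> a(2)] order_0I by simp
  have pos_part: "{#x \<in># proots p. 0 < x#} = {#a#}"
  proof (rule multiset_eqI)
    fix x
    show "count {#x \<in># proots p. 0 < x#} x = count {#a#} x"
      using order a a_unique[of x] \<open>p \<noteq> 0\<close> order_0I[of p x] by auto
  qed
  then show "size {#x \<in># eigenvalues_mset ?M. 0 < x#} = 1" by (simp add: ev)
  have "poly p 0 \<noteq> 0" using p0 e by simp
  then have "{#x \<in># proots p. x < 0#} = {#x \<in># proots p. \<not> 0 < x#}"
    using \<open>p \<noteq> 0\<close> by (intro filter_mset_cong) (auto simp: less_le)
  moreover have "size {#x \<in># proots p. 0 < x#} + size {#x \<in># proots p. \<not> 0 < x#} = 5"
    using as(1) proots multiset_partition[of "proots p" "\<lambda>x. 0 < x"]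
    by (metis size_mset size_union)
  ultimately show "size {#x \<in># eigenvalues_mset ?M. x < 0#} = 4"
    by (simp add: ev pos_part)
qed

section \<open>Hessians of quadratic forms\<close>

lemma lookup_partial_deriv:
  "Poly_Mapping.lookup (partial_deriv i f) m
    = real (Poly_Mapping.lookup m i + 1) * Poly_Mapping.lookup f (m + Poly_Mapping.single i 1)"
proof -
  let ?e = "Poly_Mapping.single i (1 :: nat)"
  \<comment> \<open>Subtraction of exponents truncates, but monomials free of the variable contribute zero.\<close>
  have split: "m' = (m' - ?e) + ?e" if "Poly_Mapping.lookup m' i \<noteq> 0" for m'
    by (rule poly_mapping_eqI) (use that in \<open>auto simp: lookup_add lookup_minus lookup_single when_def\<close>)
  have "Poly_Mapping.lookup (partial_deriv i f) m
      = (\<Sum>m'\<in>Poly_Mapping.keys f.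
          if m' = m + ?e then real (Poly_Mapping.lookup m' i) * Poly_Mapping.lookup f m' else 0)"
    unfolding partial_deriv_def lookup_sum
  proof (intro sum.cong refl)
    fix m'
    have "m' - ?e = m \<longleftrightarrow> m' = m + ?e" if "Poly_Mapping.lookup m' i \<noteq> 0"
      using split[OF that] by auto
    then show "Poly_Mapping.lookup (Poly_Mapping.single (m' - ?e)
          (real (Poly_Mapping.lookup m' i) * Poly_Mapping.lookup f m')) m
        = (if m' = m + ?e then real (Poly_Mapping.lookup m' i) * Poly_Mapping.lookup f m' else 0)"
      by (cases "Poly_Mapping.lookup m' i = 0") (auto simp: lookup_single when_def)
  qed
  also have "\<dots> = real (Poly_Mapping.lookup m i + 1) * Poly_Mapping.lookup f (m + ?e)"
    by (auto simp: lookup_add in_keys_iff)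
  finally show ?thesis .
qed

lemma hessian_index:
  assumes "i < n" "j < n"
  shows "hessian n f $$ (i, j)
    = (if i = j then 2 else 1) * Poly_Mapping.lookup f (quad_mon (Suc i) (Suc j))"
  using assms
  by (auto simp: hessian_def lookup_partial_deriv lookup_single when_def)

lemma hessian_carrier [simp]: "hessian n f \<in> carrier_mat n n"
  by (simp add: hessian_def)

lemma hessian_dim [simp]: "dim_row (hessian n f) = n" "dim_col (hessian n f) = n"
  by (simp_all add: hessian_def)

lemma transpose_hessian: "transpose_mat (hessian n f) = hessian n f"
proof (rule eq_matI)
  fix i j assume "i < dim_row (hessian n f)" "j < dim_col (hessian n f)"
  then have ij: "i < n" "j < n" by (simp_all add: hessian_def)
  have "transpose_mat (hessian n f) $$ (i, j) = hessian n f $$ (j, i)"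
    using ij by (simp add: hessian_def)
  then show "transpose_mat (hessian n f) $$ (i, j) = hessian n f $$ (i, j)"
    using ij by (simp add: hessian_index add.commute)
qed (simp_all add: hessian_def)

lemma tendsto_det:
  fixes A :: "nat \<Rightarrow> real mat"
  assumes A: "\<And>k. A k \<in> carrier_mat n n" and B: "B \<in> carrier_mat n n"
    and lim: "\<And>i j. i < n \<Longrightarrow> j < n \<Longrightarrow> (\<lambda>k. A k $$ (i, j)) \<longlonglongrightarrow> B $$ (i, j)"
  shows "(\<lambda>k. det (A k)) \<longlonglongrightarrow> det B"
  unfolding det_def'[OF A] det_def'[OF B]
  by (intro tendsto_sum tendsto_mult tendsto_const tendsto_prod lim)
    (use permutes_in_image in fastforce)+

text \<open>
  One positive and four negative eigenvalues make the determinant of a strictly Lorentzian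
  Hessian positive; the inequality passes to the limit.
\<close>

lemma det_hessian_lorentzian_nonneg:
  assumes "lorentzian 5 f"
  shows "0 \<le> det (hessian 5 f)"
proof -
  obtain F where F: "\<And>k. strictly_lorentzian 5 (F k)"
    and lim: "\<And>m. (\<lambda>k. Poly_Mapping.lookup (F k) m) \<longlonglongrightarrow> Poly_Mapping.lookup f m"
    using assms unfolding lorentzian_def by blast
  have "(\<lambda>k. det (hessian 5 (F k))) \<longlonglongrightarrow> det (hessian 5 f)"
    by (rule tendsto_det[of _ 5])
      (use lim in \<open>auto simp: hessian_index intro!: tendsto_mult\<close>)
  moreover have "0 \<le> det (hessian 5 (F k))" for k
    using det_pos_of_signature[OF hessian_carrier transpose_hessian, of "F k"] F[of k]
    by (simp add: strictly_lorentzian_def)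
  ultimately show ?thesis by (simp add: LIMSEQ_le_const)
qed

lemma keys_quad_mon: "Poly_Mapping.keys (quad_mon i j) = {i, j}"
  by (auto simp: in_keys_iff lookup_add lookup_single when_def split: if_splits)

lemma quad_mon_eq_iff:
  assumes "i < j" "a < b"
  shows "quad_mon i j = quad_mon a b \<longleftrightarrow> i = a \<and> j = b"
proof
  assume eq: "quad_mon i j = quad_mon a b"
  then have "{i, j} = {a, b}" using keys_quad_mon by metis
  then show "i = a \<and> j = b" using assms by (auto simp: doubleton_eq_iff)
qed auto

lemma lookup_rep_form:
  "Poly_Mapping.lookup (rep_form n \<rho>) m
    = (\<Sum>(i, j) \<in> {(i, j). 1 \<le> i \<and> i < j \<and> j \<le> n}. \<rho> i j when quad_mon i j = m)"
  by (auto simp: rep_form_def lookup_sum lookup_single case_prod_unfold)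

lemma finite_pairs: "finite {(i, j). 1 \<le> i \<and> i < j \<and> j \<le> (n :: nat)}"
  by (rule finite_subset[of _ "{..n} \<times> {..n}"]) auto

lemma lookup_rep_form_quad_mon:
  assumes "1 \<le> i" "i < j" "j \<le> n"
  shows "Poly_Mapping.lookup (rep_form n \<rho>) (quad_mon i j) = \<rho> i j"
proof -
  have "Poly_Mapping.lookup (rep_form n \<rho>) (quad_mon i j)
      = (\<Sum>p \<in> {(i, j). 1 \<le> i \<and> i < j \<and> j \<le> n}. if p = (i, j) then \<rho> i j else 0)"
    unfolding lookup_rep_form
    by (intro sum.cong) (use assms in \<open>auto simp: when_def quad_mon_eq_iff simp del: One_nat_def split: if_splits\<close>)
  also have "\<dots> = \<rho> i j" using assms finite_pairs[of n] by simp
  finally show ?thesis .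
qed

lemma lookup_rep_form_other:
  assumes "\<And>i j. 1 \<le> i \<Longrightarrow> i < j \<Longrightarrow> j \<le> n \<Longrightarrow> m \<noteq> quad_mon i j"
  shows "Poly_Mapping.lookup (rep_form n \<rho>) m = 0"
  unfolding lookup_rep_form
  by (rule sum.neutral) (use assms in \<open>auto simp: when_def\<close>)

text \<open>
  The symmetric array of a representation, with the indices shifted to start at \<open>0\<close>.  Only the
  values \<open>\<rho> i j\<close> with \<open>i < j\<close> are read; the diagonal is irrelevant.
\<close>

definition sym_rep :: "(nat \<Rightarrow> nat \<Rightarrow> real) \<Rightarrow> nat \<Rightarrow> nat \<Rightarrow> real" where
  "sym_rep \<rho> i j = \<rho> (Suc (min i j)) (Suc (max i j))"

lemma sym_rep_commute: "sym_rep \<rho> i j = sym_rep \<rho> j i"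
  by (simp add: sym_rep_def min.commute max.commute)

lemma hessian_rep_form: "hessian n (rep_form n \<rho>) = hollow_mat n (sym_rep \<rho>)"
proof (rule eq_matI)
  fix i j assume "i < dim_row (hollow_mat n (sym_rep \<rho>))" "j < dim_col (hollow_mat n (sym_rep \<rho>))"
  then have ij: "i < n" "j < n" by simp_all
  have "Poly_Mapping.lookup (rep_form n \<rho>) (quad_mon (Suc i) (Suc i)) = 0"
  proof (rule lookup_rep_form_other)
    fix a b :: nat assume "a < b"
    then have "Poly_Mapping.lookup (quad_mon (Suc i) (Suc i)) a \<noteq> Poly_Mapping.lookup (quad_mon a b) a"
      by (auto simp: lookup_add lookup_single when_def)
    then show "quad_mon (Suc i) (Suc i) \<noteq> quad_mon a b" by metis
  qed
  moreover have "Poly_Mapping.lookup (rep_form n \<rho>) (quad_mon (Suc i) (Suc j)) = sym_rep \<rho> i j" if "i \<noteq> j"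
  proof (cases "i < j")
    case True
    then show ?thesis using ij lookup_rep_form_quad_mon[of "Suc i" "Suc j" n \<rho>]
      by (simp add: sym_rep_def)
  next
    case False
    then show ?thesis using ij that lookup_rep_form_quad_mon[of "Suc j" "Suc i" n \<rho>]
      by (simp add: sym_rep_def add.commute)
  qed
  ultimately show "hessian n (rep_form n \<rho>) $$ (i, j) = hollow_mat n (sym_rep \<rho>) $$ (i, j)"
    using ij by (cases "i = j") (simp_all add: hessian_index)
qed (simp_all add: hessian_def)

lemma keys_rep_form:
  assumes "\<And>i j. 1 \<le> i \<Longrightarrow> i < j \<Longrightarrow> j \<le> n \<Longrightarrow> 0 < \<rho> i j"
  shows "Poly_Mapping.keys (rep_form n \<rho>) = {quad_mon i j | i j. 1 \<le> i \<and> i < j \<and> j \<le> n}"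
proof (intro equalityI subsetI)
  fix m assume "m \<in> Poly_Mapping.keys (rep_form n \<rho>)"
  then have "Poly_Mapping.lookup (rep_form n \<rho>) m \<noteq> 0" by (simp add: in_keys_iff)
  then show "m \<in> {quad_mon i j | i j. 1 \<le> i \<and> i < j \<and> j \<le> n}"
    using lookup_rep_form_other[of n m \<rho>] by auto
next
  fix m assume "m \<in> {quad_mon i j | i j. 1 \<le> i \<and> i < j \<and> j \<le> n}"
  then obtain i j where "m = quad_mon i j" "1 \<le> i" "i < j" "j \<le> n" by auto
  then show "m \<in> Poly_Mapping.keys (rep_form n \<rho>)"
    using lookup_rep_form_quad_mon[of i j n \<rho>] assms[of i j] by (simp add: in_keys_iff)
qed

lemma quadratic_form_rep_form:
  assumes "\<And>i j. 1 \<le> i \<Longrightarrow> i < j \<Longrightarrow> j \<le> n \<Longrightarrow> 0 < \<rho> i j"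
  shows "quadratic_form n (rep_form n \<rho>)"
proof -
  have "Poly_Mapping.keys (quad_mon i j) \<subseteq> {1..n} \<and>
      (\<Sum>k \<in> Poly_Mapping.keys (quad_mon i j). Poly_Mapping.lookup (quad_mon i j) k) = 2"
    if "1 \<le> i" "i < j" "j \<le> n" for i j
    unfolding keys_quad_mon using that by (auto simp: lookup_add lookup_single)
  moreover have "Poly_Mapping.keys (rep_form n \<rho>) = {quad_mon i j | i j. 1 \<le> i \<and> i < j \<and> j \<le> n}"
    using assms by (rule keys_rep_form)
  ultimately show ?thesis
    unfolding quadratic_form_def by auto
qed

lemma nonneg_coeffs_rep_form:
  assumes "\<And>i j. 1 \<le> i \<Longrightarrow> i < j \<Longrightarrow> j \<le> n \<Longrightarrow> 0 < \<rho> i j"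
  shows "nonneg_coeffs (rep_form n \<rho>)"
  unfolding nonneg_coeffs_def lookup_rep_form
  by (intro allI sum_nonneg) (use assms in \<open>auto simp: when_def less_imp_le\<close>)

section \<open>The two bounds for the threshold\<close>

lemma angles_lt_120_sym_rep:
  assumes rep: "weak_rep n q \<rho>" and q: "0 < q" "q < log 2 3"
  shows "angles_lt_120 n (sym_rep \<rho>)"
proof -
  let ?r = "sym_rep \<rho>"
  have pos: "0 < ?r i j" if "i < n" "j < n" "i \<noteq> j" for i j
  proof -
    have "1 \<le> Suc (min i j) \<and> Suc (min i j) < Suc (max i j) \<and> Suc (max i j) \<le> n" using that by auto
    then show ?thesis using rep unfolding weak_rep_def sym_rep_def by blast
  qed
  have tri: "(?r i j * ?r k l) powr (1 / q) \<le> (?r i k * ?r j l) powr (1 / q) + (?r i l * ?r j k) powr (1 / q)"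
    "(?r i k * ?r j l) powr (1 / q) \<le> (?r i j * ?r k l) powr (1 / q) + (?r i l * ?r j k) powr (1 / q)"
    "(?r i l * ?r j k) powr (1 / q) \<le> (?r i j * ?r k l) powr (1 / q) + (?r i k * ?r j l) powr (1 / q)"
    if "i < j" "j < k" "k < l" "l < n" for i j k l
  proof -
    have "1 \<le> Suc i \<and> Suc i < Suc j \<and> Suc j < Suc k \<and> Suc k < Suc l \<and> Suc l \<le> n" using that by auto
    with rep have "let a = (\<rho> (Suc i) (Suc j) * \<rho> (Suc k) (Suc l)) powr (1 / q);
             b = (\<rho> (Suc i) (Suc k) * \<rho> (Suc j) (Suc l)) powr (1 / q);
             c = (\<rho> (Suc i) (Suc l) * \<rho> (Suc j) (Suc k)) powr (1 / q)
         in a \<le> b + c \<and> b \<le> a + c \<and> c \<le> a + b"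
      unfolding weak_rep_def by blast
    then show "(?r i j * ?r k l) powr (1 / q) \<le> (?r i k * ?r j l) powr (1 / q) + (?r i l * ?r j k) powr (1 / q)"
    "(?r i k * ?r j l) powr (1 / q) \<le> (?r i j * ?r k l) powr (1 / q) + (?r i l * ?r j k) powr (1 / q)"
    "(?r i l * ?r j k) powr (1 / q) \<le> (?r i j * ?r k l) powr (1 / q) + (?r i k * ?r j l) powr (1 / q)"
      using that by (auto simp: Let_def sym_rep_def)
  qed
  \<comment> \<open>Each defining inequality is stated for sorted indices; the symmetries of \<open>P\<close> reduce all others to it.\<close>
  define P where "P i j k l \<longleftrightarrow> (?r i j * ?r k l) powr (1 / q)
    \<le> (?r i k * ?r j l) powr (1 / q) + (?r i l * ?r j k) powr (1 / q)" for i j k l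
  have P1: "P i j k l" if "P j i k l" for i j k l
    using that sym_rep_commute[of \<rho> i j] unfolding P_def by (simp add: mult.commute add.commute)
  have P2: "P i j k l" if "P i j l k" for i j k l
    using that sym_rep_commute[of \<rho> k l] unfolding P_def by (simp add: mult.commute add.commute)
  have P3: "P i j k l" if "P k l i j" for i j k l
    using that unfolding P_def sym_rep_commute[of \<rho> k i] sym_rep_commute[of \<rho> k j]
      sym_rep_commute[of \<rho> l i] sym_rep_commute[of \<rho> l j]
    by (simp add: mult.commute add.commute)
  have sorted: "P i j k l" if "i < j" "k < l" "i < k" "j < n" "l < n" "j \<noteq> k" "j \<noteq> l" for i j k l
  proof -
    consider "j < k" | "k < j" "j < l" | "l < j" using \<open>j \<noteq> k\<close> \<open>j \<noteq> l\<close> by linarith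
    then show ?thesis
    proof cases
      case 1 then show ?thesis unfolding P_def using tri(1)[of i j k l] that by simp
    next
      case 2 then show ?thesis unfolding P_def using tri(2)[of i k j l] that
        sym_rep_commute[of \<rho> j k] by simp
    next
      case 3 then show ?thesis unfolding P_def using tri(3)[of i k l j] that
        sym_rep_commute[of \<rho> j k] sym_rep_commute[of \<rho> j l] by (simp add: add.commute)
    qed
  qed
  have sorted2: "P i j k l"
    if "i < j" "k < l" "j < n" "l < n" "distinct [i, j, k, l]" for i j k l
  proof (cases "i < k")
    case True then show ?thesis using sorted that by auto
  next
    case False
    then show ?thesis using P3[OF sorted[of k l i j]] that by auto
  qed
  have P: "P i j k l" if "i < n" "j < n" "k < n" "l < n" "distinct [i, j, k, l]" for i j k l
  proof -
    have 1: "P a b k l" if "a < b" "b < n" "distinct [a, b, k, l]" for a b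
      using sorted2[of a b k l] P2[OF sorted2[of a b l k]] that \<open>k < n\<close> \<open>l < n\<close>
      by (cases "k < l") auto
    show ?thesis
      using 1[of i j] P1[OF 1[of j i]] that by (cases "i < j") auto
  qed
  show ?thesis
    unfolding angles_lt_120_def
  proof (intro conjI allI impI)
    fix i j k l assume *: "i < n" "j < n" "k < n" "l < n" "distinct [i, j, k, l]"
    then have "0 < ?r i k * ?r j l" "0 < ?r i l * ?r j k" "0 < ?r i j * ?r k l"
      by (auto intro!: mult_pos_pos pos)
    then show "?r i j * ?r k l < ?r i k * ?r j l + ?r i l * ?r j k
        + sqrt ((?r i k * ?r j l) * (?r i l * ?r j k))"
      using triangle_imp_angle_less[OF q] P[OF *] unfolding P_def by blast
  qed (use pos sym_rep_commute in auto)
qed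

lemma Gr_w_subset_PL:
  assumes q: "0 < q" "q < log 2 3"
  shows "Gr_w 5 q \<subseteq> PL 5"
proof
  fix X assume "X \<in> Gr_w 5 q"
  then obtain \<rho> where X: "X = scaling_class (rep_form 5 \<rho>)" and rep: "weak_rep 5 q \<rho>"
    unfolding Gr_w_def by blast
  have pos: "0 < \<rho> i j" if "1 \<le> i" "i < j" "j \<le> 5" for i j
    using rep that unfolding weak_rep_def by blast
  have "strictly_lorentzian 5 (rep_form 5 \<rho>)"
    unfolding strictly_lorentzian_def hessian_rep_form
    using quadratic_form_rep_form[of 5 \<rho>] nonneg_coeffs_rep_form[of 5 \<rho>] pos
      signature_hollow_mat[OF angles_lt_120_sym_rep[OF rep q]] by simp
  then have "lorentzian 5 (rep_form 5 \<rho>)"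
    unfolding lorentzian_def strictly_lorentzian_def by (auto intro!: exI[of _ "\<lambda>_. rep_form 5 \<rho>"])
  then show "X \<in> PL 5"
    unfolding PL_def X using keys_rep_form[of 5 \<rho>] pos by blast
qed

text \<open>
  On indices \<open>i < j\<close>, this is \<open>2 powr q\<close> for the pairs within \<open>{3, 4, 5}\<close> and \<open>1\<close> otherwise: the
  \<open>q\<close>-th powers of the distances in the star with centre \<open>1\<close> and leaves \<open>3, 4, 5\<close>, where \<open>2\<close> is the
  point at infinity.
\<close>

definition star_rep :: "real \<Rightarrow> nat \<Rightarrow> nat \<Rightarrow> real" where
  "star_rep q i j = (if i \<le> 2 then 1 else 2 powr q)"

lemma weak_rep_star:
  assumes "0 < q"
  shows "weak_rep 5 q (star_rep q)"
  unfolding weak_rep_def Let_def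
proof (intro conjI allI impI)
  fix i j k l :: nat
  assume *: "1 \<le> i \<and> i < j \<and> j < k \<and> k < l \<and> l \<le> 5"
  then have "i \<le> 2" "\<not> k \<le> 2" by auto
  then show "(star_rep q i j * star_rep q k l) powr (1 / q)
      \<le> (star_rep q i k * star_rep q j l) powr (1 / q) + (star_rep q i l * star_rep q j k) powr (1 / q)"
    "(star_rep q i k * star_rep q j l) powr (1 / q)
      \<le> (star_rep q i j * star_rep q k l) powr (1 / q) + (star_rep q i l * star_rep q j k) powr (1 / q)"
    "(star_rep q i l * star_rep q j k) powr (1 / q)
      \<le> (star_rep q i j * star_rep q k l) powr (1 / q) + (star_rep q i k * star_rep q j l) powr (1 / q)"
    using assms by (auto simp: star_rep_def powr_powr)
qed (auto simp: star_rep_def)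

lemma det_star:
  "det (hollow_mat 5 (sym_rep (star_rep q))) = 2 * (2 powr q)\<^sup>2 * (3 - 2 powr q)"
  unfolding hollow_mat_def det_mat_5 det_mat_4 det_mat_3
  by (simp add: sym_rep_def star_rep_def algebra_simps power2_eq_square power3_eq_cube)

lemma not_Gr_w_subset_PL:
  assumes q: "log 2 3 < q"
  shows "\<not> Gr_w 5 q \<subseteq> PL 5"
proof
  assume sub: "Gr_w 5 q \<subseteq> PL 5"
  let ?g = "rep_form 5 (star_rep q)"
  have "0 < log 2 (3 :: real)" by simp
  with q have "0 < q" by linarith
  then have "scaling_class ?g \<in> PL 5"
    using sub weak_rep_star unfolding Gr_w_def by blast
  then obtain f where f: "lorentzian 5 f" "scaling_class ?g = scaling_class f"
    unfolding PL_def by blast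
  \<comment> \<open>Equal classes only make \<open>?g\<close> a positive multiple of \<open>f\<close>, which preserves the sign of the determinant.\<close>
  have map_one: "Poly_Mapping.map (\<lambda>a. 1 * a) ?g = ?g"
    by (rule poly_mapping_eqI) (simp add: map.rep_eq when_def)
  then have "?g \<in> scaling_class ?g"
    unfolding scaling_class_def mem_Collect_eq
    by (intro exI[of _ 1] conjI) (rule map_one[symmetric], simp)
  then have "?g \<in> scaling_class f" by (simp only: f(2))
  then obtain c where c: "0 < c" and g: "?g = Poly_Mapping.map (\<lambda>a. c * a) f"
    unfolding scaling_class_def mem_Collect_eq by (elim exE conjE)
  have "hessian 5 ?g = c \<cdot>\<^sub>m hessian 5 f"
    by (rule eq_matI) (simp_all add: hessian_index g map.rep_eq when_def)
  then have "det (hessian 5 ?g) = c ^ 5 * det (hessian 5 f)"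
    by simp
  then have "0 \<le> det (hessian 5 ?g)"
    using c det_hessian_lorentzian_nonneg[OF f(1)] by simp
  moreover have "3 < 2 powr q"
    using powr_less_mono[OF q, of 2] by simp
  then have "det (hessian 5 ?g) < 0"
    unfolding hessian_rep_form det_star by (intro mult_pos_neg) auto
  ultimately show False by simp
qed

theorem corollary7p17:
  shows "q_sup 5 = ereal (log 2 3)"
proof -
  have "q_sup 5 \<le> ereal (log 2 3)"
    unfolding q_sup_def using not_Gr_w_subset_PL by (force intro!: Sup_least)
  moreover have "ereal (log 2 3) \<le> q_sup 5"
  proof (rule dense_le)
    fix y assume y: "y < ereal (log 2 3)"
    have "max y 0 < ereal (log 2 3)" using y by simp
    then obtain q where q: "max y 0 < ereal q" "ereal q < ereal (log 2 3)"
      using ereal_dense2 by blast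
    then have "0 < q" "q < log 2 3" by (simp_all add: zero_ereal_def[symmetric])
    then have "ereal q \<le> q_sup 5"
      unfolding q_sup_def using Gr_w_subset_PL by (intro Sup_upper) auto
    moreover have "y \<le> ereal q" using q(1) by (simp add: less_imp_le)
    ultimately show "y \<le> q_sup 5" by simp
  qed
  ultimately show ?thesis by (rule antisym)
qed

end
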